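(* Let $D$ be an integral domain that is not a field, and suppose that $D$ is a $t$-ACC domain. Then (1) $D$ is a PID if and only if $I(D)\vartriangleleft P$ for $P=$ "is a proper nonzero principal ideal"; (2) $D$ is a Dedekind domain if and only if $I(D)\vartriangleleft P$ for $P=$ "is a proper invertible ideal"; (3) $D$ is a Krull domain if and only if $I_t(D)\vartriangleleft P$ for $P=$ "is a proper $t$-invertible $t$-ideal".
   Context: Let $K$ be the quotient field of $D$. For a nonzero fractional ideal $I$ of $D$: $I^{-1}=\{x\in K: xI\subseteq D\}$, $I_v=(I^{-1})^{-1}$, and $I_t=\bigcup\{J_v: J\subseteq I \text{ a nonzero finitely generated ideal}\}$. $I$ is a $t$-ideal if $I=I_t$, and $t$-invertible if $(II^{-1})_t=D$. $D$ is a $t$-ACC domain if it satisfies the ascending chain condition on its (integral) $t$-invertible $t$-ideals. $I(D)$ is the set of nonzero proper integral ideals of $D$, and $I_t(D)$ is the set of (nonzero) proper integral $t$-ideals of $D$. For $S(D)=I(D)$ or $I_t(D)$ and a property $P$ of ideals, $S(D)\vartriangleleft P$ means that every $s\in S(D)$ is contained in some $\gamma\in S(D)$ satisfying $P$. *)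

theory Defs
  imports "HOL-Algebra.Algebra"
begin

text \<open>
  Throughout, \<open>D\<close> is a subset of the carrier of \<open>K\<close>, and the ring \<open>D\<close> itself is
  \<open>K\<lparr>carrier := D\<rparr>\<close>. Working inside \<open>K\<close> makes fractional ideals plain subsets of one carrier.
\<close>

locale quotient_field = field K + subdomain D K for K (structure) and D +
  assumes fraction: "x \<in> carrier K \<Longrightarrow> \<exists>a \<in> D. \<exists>b \<in> D - {\<zero>}. x = a \<otimes> inv b"

definition submodule_of :: "('a, 'b) ring_scheme \<Rightarrow> 'a set \<Rightarrow> 'a set \<Rightarrow> bool" where
  "submodule_of K D M \<longleftrightarrow>
     additive_subgroup M K \<and> (\<forall>d \<in> D. \<forall>x \<in> M. d \<otimes>\<^bsub>K\<^esub> x \<in> M)"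

definition nonzero_fractional_ideal :: "('a, 'b) ring_scheme \<Rightarrow> 'a set \<Rightarrow> 'a set \<Rightarrow> bool" where
  "nonzero_fractional_ideal K D M \<longleftrightarrow>
     submodule_of K D M \<and> M \<noteq> {\<zero>\<^bsub>K\<^esub>} \<and>
     (\<exists>d \<in> D - {\<zero>\<^bsub>K\<^esub>}. \<forall>x \<in> M. d \<otimes>\<^bsub>K\<^esub> x \<in> D)"

definition nonzero_integral_ideal :: "('a, 'b) ring_scheme \<Rightarrow> 'a set \<Rightarrow> 'a set \<Rightarrow> bool" where
  "nonzero_integral_ideal K D M \<longleftrightarrow> ideal M (K\<lparr>carrier := D\<rparr>) \<and> M \<noteq> {\<zero>\<^bsub>K\<^esub>}"

definition ideal_inv :: "('a, 'b) ring_scheme \<Rightarrow> 'a set \<Rightarrow> 'a set \<Rightarrow> 'a set" where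
  "ideal_inv K D M = {x \<in> carrier K. \<forall>y \<in> M. x \<otimes>\<^bsub>K\<^esub> y \<in> D}"

definition v_closure :: "('a, 'b) ring_scheme \<Rightarrow> 'a set \<Rightarrow> 'a set \<Rightarrow> 'a set" where
  "v_closure K D M = ideal_inv K D (ideal_inv K D M)"

text \<open>
  \<open>ring.Span K D us\<close> is the set of \<open>D\<close>-linear combinations of the list \<open>us\<close>; the definition of
  \<open>Span\<close> makes sense for any set of scalars, although most library facts about it are for subfields.
\<close>

definition finitely_generated :: "('a, 'b) ring_scheme \<Rightarrow> 'a set \<Rightarrow> 'a set \<Rightarrow> bool" where
  "finitely_generated K D M \<longleftrightarrow> (\<exists>us. set us \<subseteq> carrier K \<and> M = ring.Span K D us)"

definition t_closure :: "('a, 'b) ring_scheme \<Rightarrow> 'a set \<Rightarrow> 'a set \<Rightarrow> 'a set" where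
  "t_closure K D M =
     \<Union> {v_closure K D J |J. J \<subseteq> M \<and> nonzero_fractional_ideal K D J \<and> finitely_generated K D J}"

definition t_ideal :: "('a, 'b) ring_scheme \<Rightarrow> 'a set \<Rightarrow> 'a set \<Rightarrow> bool" where
  "t_ideal K D M \<longleftrightarrow> nonzero_fractional_ideal K D M \<and> t_closure K D M = M"

text \<open>
  \<open>ideal_prod K\<close> closes the pairwise products under addition, which for \<open>D\<close>-submodules of \<open>K\<close>
  (not just ideals of \<open>K\<close>) is the usual product.
\<close>

definition invertible_ideal :: "('a, 'b) ring_scheme \<Rightarrow> 'a set \<Rightarrow> 'a set \<Rightarrow> bool" where
  "invertible_ideal K D M \<longleftrightarrow>
     nonzero_fractional_ideal K D M \<and> ideal_prod K M (ideal_inv K D M) = D"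

definition t_invertible :: "('a, 'b) ring_scheme \<Rightarrow> 'a set \<Rightarrow> 'a set \<Rightarrow> bool" where
  "t_invertible K D M \<longleftrightarrow>
     nonzero_fractional_ideal K D M \<and> t_closure K D (ideal_prod K M (ideal_inv K D M)) = D"

definition t_ACC :: "('a, 'b) ring_scheme \<Rightarrow> 'a set \<Rightarrow> bool" where
  "t_ACC K D \<longleftrightarrow>
     (\<forall>J :: nat \<Rightarrow> 'a set.
        (\<forall>n. nonzero_integral_ideal K D (J n) \<and> t_ideal K D (J n) \<and> t_invertible K D (J n)) \<and>
        (\<forall>n. J n \<subseteq> J (Suc n)) \<longrightarrow>
        (\<exists>N. \<forall>n \<ge> N. J n = J N))"

definition proper_ideals :: "('a, 'b) ring_scheme \<Rightarrow> 'a set \<Rightarrow> 'a set set" where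
  "proper_ideals K D = {M. nonzero_integral_ideal K D M \<and> M \<noteq> D}"

definition proper_t_ideals :: "('a, 'b) ring_scheme \<Rightarrow> 'a set \<Rightarrow> 'a set set" where
  "proper_t_ideals K D = {M \<in> proper_ideals K D. t_ideal K D M}"

definition each_contained_in :: "'a set set \<Rightarrow> ('a set \<Rightarrow> bool) \<Rightarrow> bool" (infix "\<lhd>\<^sub>P" 50) where
  "S \<lhd>\<^sub>P P \<longleftrightarrow> (\<forall>s \<in> S. \<exists>g \<in> S. s \<subseteq> g \<and> P g)"

definition integral_over :: "('a, 'b) ring_scheme \<Rightarrow> 'a set \<Rightarrow> 'a \<Rightarrow> bool" where
  "integral_over K D x \<longleftrightarrow>
     (\<exists>p \<in> carrier (univ_poly K D).
        p \<noteq> [] \<and> lead_coeff p = \<one>\<^bsub>K\<^esub> \<and> ring.eval K p x = \<zero>\<^bsub>K\<^esub>)"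

definition dedekind_domain :: "('a, 'b) ring_scheme \<Rightarrow> 'a set \<Rightarrow> bool" where
  "dedekind_domain K D \<longleftrightarrow>
     noetherian_domain (K\<lparr>carrier := D\<rparr>) \<and>
     (\<forall>x \<in> carrier K. integral_over K D x \<longrightarrow> x \<in> D) \<and>
     (\<forall>Q. primeideal Q (K\<lparr>carrier := D\<rparr>) \<and> Q \<noteq> {\<zero>\<^bsub>K\<^esub>} \<longrightarrow> maximalideal Q (K\<lparr>carrier := D\<rparr>))"

text \<open>
  Normalized discrete valuations, with value group all of the integers. The value at zero, which would
  be infinite, is unconstrained and never used.
\<close>

definition discrete_valuation :: "('a, 'b) ring_scheme \<Rightarrow> ('a \<Rightarrow> int) \<Rightarrow> bool" where
  "discrete_valuation K v \<longleftrightarrow>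
     (\<forall>x \<in> carrier K - {\<zero>\<^bsub>K\<^esub>}. \<forall>y \<in> carrier K - {\<zero>\<^bsub>K\<^esub>}.
        v (x \<otimes>\<^bsub>K\<^esub> y) = v x + v y \<and>
        (x \<oplus>\<^bsub>K\<^esub> y \<noteq> \<zero>\<^bsub>K\<^esub> \<longrightarrow> min (v x) (v y) \<le> v (x \<oplus>\<^bsub>K\<^esub> y))) \<and>
     v ` (carrier K - {\<zero>\<^bsub>K\<^esub>}) = UNIV"

text \<open>
  Bourbaki's definition: \<open>D\<close> is the intersection of the valuation rings of a family of discrete
  valuations of \<open>K\<close> of finite character. A set of valuations suffices, since finite character allows
  each valuation to occur only finitely often in a family.
\<close>

definition krull_domain :: "('a, 'b) ring_scheme \<Rightarrow> 'a set \<Rightarrow> bool" where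
  "krull_domain K D \<longleftrightarrow>
     (\<exists>V. (\<forall>v \<in> V. discrete_valuation K v) \<and>
          (\<forall>x \<in> carrier K - {\<zero>\<^bsub>K\<^esub>}. x \<in> D \<longleftrightarrow> (\<forall>v \<in> V. 0 \<le> v x)) \<and>
          (\<forall>x \<in> carrier K - {\<zero>\<^bsub>K\<^esub>}. finite {v \<in> V. v x \<noteq> 0}))"

end

theory Submission
  imports Defs
begin

text \<open>
  If \<open>I\<close> is an integral ideal contained in a proper ideal \<open>J\<close> that is invertible (in any of the three
  senses), then \<open>I J\<^sup>-\<^sup>1\<close> is again integral and contains \<open>I\<close>. Iterating need not terminate on \<open>I\<close>
  itself, but a principal ideal \<open>x D \<subseteq> I\<close> is divided along the way, and its quotients form a strictly
  increasing chain of \<open>t\<close>-invertible \<open>t\<close>-ideals. By \<open>t\<close>-ACC the process stops at \<open>D\<close>, so \<open>I\<close> is a product of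
  the ideals divided out. Hence all nonzero ideals are principal, respectively invertible,
  respectively all \<open>t\<close>-ideals are \<open>t\<close>-invertible, which characterises PIDs, Dedekind domains and Krull
  domains. In the Krull case the valuations come from the maximal \<open>t\<close>-ideals; conversely, in a Krull
  domain every ideal has a finite subset with the same values, so that \<open>t = v\<close>, and complete
  integral closedness makes every ideal \<open>v\<close>-invertible.
\<close>

text \<open>The obstacle is that \<open>t_ACC\<close> says nothing about an ideal I that is not yet
  known to be t-invertible, so I itself can never be placed in a chain. Only a smaller ideal A
  \<subseteq> I that already lies in a group of good ideals is compared, while I merely has to stay
  outside the group. The three equivalences share one argument because the identity and the
  t-closure are both star operations. What varies is the group: the nonzero principal fractional
  ideals, the invertible ideals, or the t-invertible t-ideals. Invertible ideals are t-invertible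
  t-ideals, and this is why a chain condition on the latter also controls the first two cases. The
  weight of the opposite directions differs. A PID or a Krull domain lets every relevant ideal cover
  itself, whereas for a Dedekind domain, defined by noetherianity, integral closedness and dimension
  one, a maximal ideal has to be shown invertible.\<close>

context quotient_field
begin

abbreviation fractional where "fractional \<equiv> nonzero_fractional_ideal K D"
abbreviation inv_ideal where "inv_ideal \<equiv> ideal_inv K D"
abbreviation v_cl where "v_cl \<equiv> v_closure K D"
abbreviation t_cl where "t_cl \<equiv> t_closure K D"
abbreviation subring_D where "subring_D \<equiv> K\<lparr>carrier := D\<rparr>"

text \<open>The principal fractional ideal of an arbitrary element of \<open>K\<close>. The factor
  from \<open>D\<close> stands on the left, as in the library's \<open>PIdl\<close>, with which it
  agrees.\<close>

definition multiples :: "'a \<Rightarrow> 'a set"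
  where "multiples x = (\<lambda>d. d \<otimes> x) ` D"

section \<open>Elements of D, inverses and denominators\<close>

lemma D_subdomain: "subdomain D K"
  by (rule subdomain_axioms)

lemma D_carr: "x \<in> D \<Longrightarrow> x \<in> carrier K"
  using subdomainE(1)[OF D_subdomain] by auto

lemma D_closed [simp]:
  "\<zero> \<in> D" "\<one> \<in> D"
  "x \<in> D \<Longrightarrow> \<ominus> x \<in> D"
  "x \<in> D \<Longrightarrow> y \<in> D \<Longrightarrow> x \<otimes> y \<in> D"
  "x \<in> D \<Longrightarrow> y \<in> D \<Longrightarrow> x \<oplus> y \<in> D"
  using subdomainE[OF D_subdomain] by auto

lemma D_pow: "x \<in> D \<Longrightarrow> x [^] (n::nat) \<in> D"
  by (induction n) (auto simp: nat_pow_Suc)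

lemma subring_D_domain: "domain subring_D"
  using subdomain_iff[OF subdomainE(1)[OF D_subdomain]] D_subdomain by simp

lemma inv_facts:
  assumes "x \<in> carrier K" "x \<noteq> \<zero>"
  shows "inv x \<in> carrier K" "x \<otimes> inv x = \<one>" "inv x \<otimes> x = \<one>" "inv x \<noteq> \<zero>"
proof -
  have "x \<in> Units K" using assms field_Units by auto
  then show *: "inv x \<in> carrier K" "x \<otimes> inv x = \<one>" "inv x \<otimes> x = \<one>" by auto
  show "inv x \<noteq> \<zero>" using *(2) assms(1) by auto
qed

lemma common_denominator:
  assumes "x \<in> carrier K"
  obtains d where "d \<in> D" "d \<noteq> \<zero>" "d \<otimes> x \<in> D"
proof -
  obtain a b where ab: "a \<in> D" "b \<in> D" "b \<noteq> \<zero>" "x = a \<otimes> inv b"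
    using fraction[OF assms] by auto
  note c = inv_facts[OF D_carr[OF ab(2)] ab(3)]
  have "b \<otimes> x = a \<otimes> (inv b \<otimes> b)"
    unfolding ab(4) using D_carr[OF ab(1)] D_carr[OF ab(2)] c(1) by algebra
  then have "b \<otimes> x = a" using c D_carr[OF ab(1)] by simp
  then show thesis using that ab by metis
qed

subsection \<open>Fractional ideals\<close>

text \<open>Closure under negatives comes from scaling by \<open>\<ominus> \<one>\<close>, an
  element of \<open>D\<close>.\<close>

lemma submoduleI:
  assumes "M \<subseteq> carrier K" "\<zero> \<in> M" "\<And>x y. x \<in> M \<Longrightarrow> y \<in> M \<Longrightarrow> x \<oplus> y \<in> M"
    "\<And>d x. d \<in> D \<Longrightarrow> x \<in> M \<Longrightarrow> d \<otimes> x \<in> M"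
  shows "submodule_of K D M"
proof -
  have "\<ominus> x \<in> M" if "x \<in> M" for x
  proof -
    have "(\<ominus> \<one>) \<otimes> x \<in> M" using assms(4)[of "\<ominus> \<one>" x] that by simp
    moreover have "(\<ominus> \<one>) \<otimes> x = \<ominus> x" using that assms(1) by (simp add: l_minus subset_iff)
    ultimately show ?thesis by simp
  qed
  then have "subgroup M (add_monoid K)"
    using assms by (intro add.subgroupI) auto
  then show ?thesis unfolding submodule_of_def using assms(4) additive_subgroupI by blast
qed

lemma submoduleE:
  assumes "submodule_of K D M"
  shows "x \<in> M \<Longrightarrow> x \<in> carrier K" "\<zero> \<in> M" "x \<in> M \<Longrightarrow> y \<in> M \<Longrightarrow> x \<oplus> y \<in> M"
    "d \<in> D \<Longrightarrow> x \<in> M \<Longrightarrow> d \<otimes> x \<in> M" "x \<in> M \<Longrightarrow> \<ominus> x \<in> M"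
proof -
  have a: "additive_subgroup M K" using assms by (simp add: submodule_of_def)
  show "x \<in> M \<Longrightarrow> x \<in> carrier K" using additive_subgroup.a_subset[OF a] by auto
  show "\<zero> \<in> M" using additive_subgroup.zero_closed[OF a] .
  show "x \<in> M \<Longrightarrow> y \<in> M \<Longrightarrow> x \<oplus> y \<in> M" using additive_subgroup.a_closed[OF a] .
  show "d \<in> D \<Longrightarrow> x \<in> M \<Longrightarrow> d \<otimes> x \<in> M" using assms by (simp add: submodule_of_def)
  show "x \<in> M \<Longrightarrow> \<ominus> x \<in> M"
    using subgroup.m_inv_closed[OF additive_subgroup.a_subgroup[OF a]] by (simp add: a_inv_def)
qed

lemma submodule_Span:
  assumes "set us \<subseteq> carrier K"
  shows "submodule_of K D (Span D us)"
  using assms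
proof (induction us)
  case Nil
  then show ?case by (intro submoduleI) (auto dest: D_carr)
next
  case (Cons u us)
  then have u: "u \<in> carrier K" and IH: "submodule_of K D (Span D us)" by auto
  note E = submoduleE[OF IH]
  have *: "x \<in> Span D (u # us) \<longleftrightarrow> (\<exists>d \<in> D. \<exists>s \<in> Span D us. x = d \<otimes> u \<oplus> s)" for x
    by (simp add: line_extension_mem_iff)
  show ?case
  proof (rule submoduleI)
    show "Span D (u # us) \<subseteq> carrier K" using u E(1) D_carr by (auto simp: * simp del: Span.simps)
    show "\<zero> \<in> Span D (u # us)" unfolding * using u E(2) by (intro bexI[of _ \<zero>]) auto
  next
    fix x y assume "x \<in> Span D (u # us)" "y \<in> Span D (u # us)"
    then obtain d s d' s' where 1: "d \<in> D" "s \<in> Span D us" "x = d \<otimes> u \<oplus> s"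
      "d' \<in> D" "s' \<in> Span D us" "y = d' \<otimes> u \<oplus> s'" unfolding * by blast
    have "x \<oplus> y = (d \<oplus> d') \<otimes> u \<oplus> (s \<oplus> s')"
      using 1 u E(1)[OF 1(2)] E(1)[OF 1(5)] D_carr[OF 1(1)] D_carr[OF 1(4)] by algebra
    then show "x \<oplus> y \<in> Span D (u # us)" unfolding * using 1 E(3) D_closed(5) by blast
  next
    fix e x assume e: "e \<in> D" and x: "x \<in> Span D (u # us)"
    obtain d s where 1: "d \<in> D" "s \<in> Span D us" "x = d \<otimes> u \<oplus> s"
      using x unfolding * by blast
    have "e \<otimes> x = (e \<otimes> d) \<otimes> u \<oplus> (e \<otimes> s)"
      using 1 u E(1)[OF 1(2)] D_carr[OF 1(1)] D_carr[OF e] by algebra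
    then show "e \<otimes> x \<in> Span D (u # us)" unfolding * using 1 e E(4) D_closed(4) by blast
  qed
qed

lemma Span_incl:
  assumes "set us \<subseteq> carrier K"
  shows "set us \<subseteq> Span D us"
  using assms
proof (induction us)
  case (Cons u us)
  then have u: "u \<in> carrier K" and IH: "set us \<subseteq> Span D us"
    and sub: "submodule_of K D (Span D us)" using submodule_Span by auto
  have *: "x \<in> Span D (u # us) \<longleftrightarrow> (\<exists>d \<in> D. \<exists>s \<in> Span D us. x = d \<otimes> u \<oplus> s)" for x
    by (simp add: line_extension_mem_iff)
  have "u = \<one> \<otimes> u \<oplus> \<zero>" using u by simp
  then have 1: "u \<in> Span D (u # us)"
    unfolding * using submoduleE(2)[OF sub] D_closed(2) by blast
  have "x \<in> Span D (u # us)" if "x \<in> set us" for x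
  proof -
    have "x = \<zero> \<otimes> u \<oplus> x" using u that Cons by auto
    then show ?thesis unfolding * using that IH D_closed(1) by blast
  qed
  with 1 show ?case by (auto simp del: Span.simps)
qed auto

lemma Span_least:
  assumes "submodule_of K D M" "set us \<subseteq> M"
  shows "Span D us \<subseteq> M"
  using assms(2)
proof (induction us)
  case Nil
  then show ?case using submoduleE(2)[OF assms(1)] by auto
next
  case (Cons u us)
  show ?case
  proof
    fix x assume "x \<in> Span D (u # us)"
    then obtain d s where "d \<in> D" "s \<in> Span D us" "x = d \<otimes> u \<oplus> s"
      by (auto simp: line_extension_mem_iff)
    then show "x \<in> M" using Cons submoduleE(3,4)[OF assms(1)] by auto
  qed
qed

text \<open>Transfers the library's ideals of the subring to \<open>D\<close>-submodules of
  \<open>K\<close>, so that products and inverses, which may leave \<open>D\<close>, live in the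
  same carrier.\<close>

lemma ideal_iff_submodule:
  "ideal M subring_D \<longleftrightarrow> submodule_of K D M \<and> M \<subseteq> D"
proof
  assume a: "ideal M subring_D"
  have s: "additive_subgroup M subring_D" using ideal.axioms(1)[OF a] .
  have MD: "M \<subseteq> D" using additive_subgroup.a_subset[OF s] by simp
  have "submodule_of K D M"
  proof (rule submoduleI)
    show "M \<subseteq> carrier K" using MD D_carr by auto
    show "\<zero> \<in> M" using additive_subgroup.zero_closed[OF s] by simp
    show "x \<oplus> y \<in> M" if "x \<in> M" "y \<in> M" for x y
      using additive_subgroup.a_closed[OF s that] by simp
    show "d \<otimes> x \<in> M" if "d \<in> D" "x \<in> M" for d x
      using ideal.I_l_closed[OF a] that by simp
  qed
  then show "submodule_of K D M \<and> M \<subseteq> D" using MD by simp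
next
  assume a: "submodule_of K D M \<and> M \<subseteq> D"
  then have s: "submodule_of K D M" by simp
  interpret R: domain subring_D by (rule subring_D_domain)
  \<comment> \<open>Negation in the subring belongs to another record; uniqueness of additive
    inverses identifies it with negation in \<open>K\<close>.\<close>
  have inv': "\<ominus>\<^bsub>subring_D\<^esub> x = \<ominus> x" if "x \<in> M" for x
    using that a R.minus_equality[of "\<ominus> x" x] submoduleE(1)[OF s that] l_neg by auto
  show "ideal M subring_D"
  proof (rule idealI)
    show "ring subring_D" by (rule R.ring_axioms)
    show "subgroup M (add_monoid subring_D)"
    proof (rule R.add.subgroupI)
      show "\<ominus>\<^bsub>subring_D\<^esub> x \<in> M" if "x \<in> M" for x
        using inv'[OF that] submoduleE(5)[OF s that] by simp
    qed (use a submoduleE[OF s] in auto)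
  next
    fix x y assume "x \<in> M" "y \<in> carrier subring_D"
    then show "y \<otimes>\<^bsub>subring_D\<^esub> x \<in> M" "x \<otimes>\<^bsub>subring_D\<^esub> y \<in> M"
      using submoduleE(4)[OF s] submoduleE(1)[OF s] D_carr m_comm[of x y] by auto
  qed
qed

lemma fracI:
  assumes "submodule_of K D M" "m \<in> M" "m \<noteq> \<zero>" "d \<in> D" "d \<noteq> \<zero>" "\<And>x. x \<in> M \<Longrightarrow> d \<otimes> x \<in> D"
  shows "fractional M"
  using assms unfolding nonzero_fractional_ideal_def by blast

lemma fracE:
  assumes "fractional M"
  shows "submodule_of K D M" "\<exists>m \<in> M. m \<noteq> \<zero>" "\<exists>d \<in> D. d \<noteq> \<zero> \<and> (\<forall>x \<in> M. d \<otimes> x \<in> D)"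
    "x \<in> M \<Longrightarrow> x \<in> carrier K"
  using assms submoduleE(1,2) unfolding nonzero_fractional_ideal_def by blast+

lemma nonzero_integral_iff:
  "nonzero_integral_ideal K D M \<longleftrightarrow> fractional M \<and> M \<subseteq> D"
proof
  assume "nonzero_integral_ideal K D M"
  then have a: "submodule_of K D M" "M \<subseteq> D" "M \<noteq> {\<zero>}"
    unfolding nonzero_integral_ideal_def ideal_iff_submodule by auto
  then obtain m where "m \<in> M" "m \<noteq> \<zero>" using submoduleE(2)[OF a(1)] by blast
  then have "fractional M" using a D_carr by (intro fracI[of M m \<one>]) auto
  with a show "fractional M \<and> M \<subseteq> D" by simp
next
  assume "fractional M \<and> M \<subseteq> D"
  then show "nonzero_integral_ideal K D M"
    unfolding nonzero_integral_ideal_def ideal_iff_submodule using fracE(1,2) by blast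
qed

lemma frac_integral_elem:
  assumes "fractional M"
  obtains m where "m \<in> M" "m \<in> D" "m \<noteq> \<zero>"
proof -
  obtain m where m: "m \<in> M" "m \<noteq> \<zero>" using fracE(2)[OF assms] by blast
  obtain d where d: "d \<in> D" "d \<noteq> \<zero>" "d \<otimes> m \<in> D"
    using common_denominator[OF fracE(4)[OF assms m(1)]] by blast
  have "d \<otimes> m \<noteq> \<zero>" using m d D_carr fracE(4)[OF assms m(1)] integral_iff by auto
  then show thesis using that d submoduleE(4)[OF fracE(1)[OF assms] d(1) m(1)] by blast
qed

lemma submodule_D: "submodule_of K D D"
  by (intro submoduleI) (auto dest: D_carr)

lemma frac_D: "fractional D"
  by (rule fracI[OF submodule_D, of \<one> \<one>]) (auto dest: D_carr)

lemma frac_subset: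
  assumes "submodule_of K D M" "fractional N" "M \<subseteq> N" "m \<in> M" "m \<noteq> \<zero>"
  shows "fractional M"
  using fracE(3)[OF assms(2)] assms fracI by blast

section \<open>Inverses of fractional ideals\<close>

lemma submodule_ideal_inv: "F \<subseteq> carrier K \<Longrightarrow> submodule_of K D (inv_ideal F)"
  by (rule submoduleI) (auto simp: ideal_inv_def subset_iff l_distr m_assoc D_carr)

lemma ideal_inv_antimono: "M \<subseteq> N \<Longrightarrow> inv_ideal N \<subseteq> inv_ideal M"
  unfolding ideal_inv_def by auto

text \<open>The two witnesses exchange roles: a common denominator of \<open>M\<close> is a nonzero
  element of the inverse, and a nonzero element of \<open>M\<close> in \<open>D\<close> is a common
  denominator of the inverse.\<close>

lemma frac_ideal_inv:
  assumes "fractional M"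
  shows "fractional (inv_ideal M)"
proof -
  obtain m where m: "m \<in> M" "m \<in> D" "m \<noteq> \<zero>" using frac_integral_elem[OF assms] .
  obtain d where d: "d \<in> D" "d \<noteq> \<zero>" "\<forall>x \<in> M. d \<otimes> x \<in> D" using fracE(3)[OF assms] by blast
  show ?thesis
  proof (rule fracI[of _ d m])
    show "submodule_of K D (inv_ideal M)" using submodule_ideal_inv fracE(4)[OF assms] by blast
    show "d \<in> inv_ideal M" unfolding ideal_inv_def using d D_carr by auto
    show "m \<otimes> x \<in> D" if "x \<in> inv_ideal M" for x
      using that m unfolding ideal_inv_def by (auto simp: m_comm D_carr)
  qed (use m d in auto)
qed

lemma ideal_invD: "x \<in> inv_ideal M \<Longrightarrow> m \<in> M \<Longrightarrow> x \<otimes> m \<in> D" "x \<in> inv_ideal M \<Longrightarrow> x \<in> carrier K"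
  by (auto simp: ideal_inv_def)

lemma ideal_inv_D: "inv_ideal D = D"
proof
  show "inv_ideal D \<subseteq> D" using ideal_invD(1)[of _ D \<one>] ideal_invD(2)[of _ D] by auto
  show "D \<subseteq> inv_ideal D" by (auto simp: ideal_inv_def D_carr)
qed

subsection \<open>Products\<close>

text \<open>The universal property of the product. Nearly every later inclusion of products is
  checked through it on pairs of factors only.\<close>

lemma prod_le:
  assumes "submodule_of K D L" "\<And>m n. m \<in> M \<Longrightarrow> n \<in> N \<Longrightarrow> m \<otimes> n \<in> L"
  shows "M \<cdot> N \<subseteq> L"
proof
  fix x assume "x \<in> M \<cdot> N"
  then show "x \<in> L" by induction (use assms submoduleE(3) in auto)
qed

lemma submodule_prod:
  assumes "submodule_of K D M" "submodule_of K D N"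
  shows "submodule_of K D (M \<cdot> N)"
proof (rule submoduleI)
  show *: "M \<cdot> N \<subseteq> carrier K"
  proof
    fix x assume "x \<in> M \<cdot> N"
    then show "x \<in> carrier K" by induction (use assms submoduleE(1) in auto)
  qed
  show "\<zero> \<in> M \<cdot> N" using ideal_prod.prod[of \<zero> M \<zero> N K] submoduleE(2) assms by auto
  show "d \<otimes> x \<in> M \<cdot> N" if "d \<in> D" "x \<in> M \<cdot> N" for d x
    using that(2)
  proof induction
    case (prod i j)
    have "d \<otimes> (i \<otimes> j) = (d \<otimes> i) \<otimes> j"
      using prod that assms by (simp add: m_assoc submoduleE(1) D_carr)
    then show ?case
      using ideal_prod.prod[of "d \<otimes> i" M j N K] prod that submoduleE(4)[OF assms(1)] by auto
  next
    case (sum s1 s2)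
    have "d \<otimes> (s1 \<oplus> s2) = d \<otimes> s1 \<oplus> d \<otimes> s2"
      using * sum that by (intro r_distr) (auto dest: D_carr)
    then show ?case using ideal_prod.sum sum by metis
  qed
qed (auto intro: ideal_prod.sum)

lemma frac_prod:
  assumes "fractional M" "fractional N"
  shows "fractional (M \<cdot> N)"
proof -
  note s = fracE(1)[OF assms(1)] fracE(1)[OF assms(2)]
  obtain m n where mn: "m \<in> M" "m \<noteq> \<zero>" "n \<in> N" "n \<noteq> \<zero>"
    using fracE(2)[OF assms(1)] fracE(2)[OF assms(2)] by blast
  obtain d e where d: "d \<in> D" "d \<noteq> \<zero>" "\<And>x. x \<in> M \<Longrightarrow> d \<otimes> x \<in> D"
    and e: "e \<in> D" "e \<noteq> \<zero>" "\<And>x. x \<in> N \<Longrightarrow> e \<otimes> x \<in> D"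
    using fracE(3)[OF assms(1)] fracE(3)[OF assms(2)] by metis
  note c = submoduleE(1)[OF s(1)] submoduleE(1)[OF s(2)] D_carr
  \<comment> \<open>The elements with denominator \<open>d \<otimes> e\<close> form a submodule, so
    it is enough to test products of two factors.\<close>
  have le: "M \<cdot> N \<subseteq> {x \<in> carrier K. (d \<otimes> e) \<otimes> x \<in> D}"
  proof (rule prod_le)
    show "submodule_of K D {x \<in> carrier K. (d \<otimes> e) \<otimes> x \<in> D}"
    proof (rule submoduleI)
      fix b x assume b: "b \<in> D" "x \<in> {x \<in> carrier K. (d \<otimes> e) \<otimes> x \<in> D}"
      then have "(d \<otimes> e) \<otimes> (b \<otimes> x) = b \<otimes> ((d \<otimes> e) \<otimes> x)"
        using c(3)[OF d(1)] c(3)[OF e(1)] c(3)[OF b(1)] by (simp add: m_ac)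
      then show "b \<otimes> x \<in> {x \<in> carrier K. (d \<otimes> e) \<otimes> x \<in> D}"
        using b D_carr D_closed(4)[of b "(d \<otimes> e) \<otimes> x"] by auto
    qed (use d e D_carr in \<open>auto simp: r_distr\<close>)
    fix m n assume mn: "m \<in> M" "n \<in> N"
    have "(d \<otimes> e) \<otimes> (m \<otimes> n) = (d \<otimes> m) \<otimes> (e \<otimes> n)"
      using c(1)[OF mn(1)] c(2)[OF mn(2)] c(3)[OF d(1)] c(3)[OF e(1)] by (simp add: m_ac)
    then show "m \<otimes> n \<in> {x \<in> carrier K. (d \<otimes> e) \<otimes> x \<in> D}"
      using d e mn c by auto
  qed
  show ?thesis
    by (rule fracI[of _ "m \<otimes> n" "d \<otimes> e"])
      (use s submodule_prod mn c d e le integral_iff in \<open>auto intro: ideal_prod.prod\<close>)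
qed

lemma prod_le_prod: "M \<subseteq> M' \<Longrightarrow> N \<subseteq> N' \<Longrightarrow> M \<cdot> N \<subseteq> M' \<cdot> N'"
proof
  fix x assume "M \<subseteq> M'" "N \<subseteq> N'" "x \<in> M \<cdot> N"
  from this(3,1,2) show "x \<in> M' \<cdot> N'"
    by induction (auto intro: ideal_prod.intros)
qed

lemma prod_comm:
  assumes "fractional M" "fractional N"
  shows "M \<cdot> N = N \<cdot> M"
proof -
  have "M \<cdot> N \<subseteq> N \<cdot> M" if "fractional M" "fractional N" for M N
  proof (rule prod_le)
    show "submodule_of K D (N \<cdot> M)" using that fracE(1) submodule_prod by auto
    fix m n assume "m \<in> M" "n \<in> N"
    then show "m \<otimes> n \<in> N \<cdot> M"
      using ideal_prod.prod[of n N m M K] m_comm fracE(4) that by metis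
  qed
  then show ?thesis using assms by blast
qed

lemma prod_assoc_le:
  assumes "fractional M" "fractional N" "fractional L"
  shows "(M \<cdot> N) \<cdot> L \<subseteq> M \<cdot> (N \<cdot> L)"
proof (rule prod_le)
  have s: "submodule_of K D (M \<cdot> (N \<cdot> L))" using assms fracE(1) submodule_prod by auto
  then show "submodule_of K D (M \<cdot> (N \<cdot> L))" .
  fix x l assume x: "x \<in> M \<cdot> N" and l: "l \<in> L"
  have lc: "l \<in> carrier K" using l assms fracE(4) by blast
  from x show "x \<otimes> l \<in> M \<cdot> (N \<cdot> L)"
  proof induction
    case (prod i j)
    have "(i \<otimes> j) \<otimes> l = i \<otimes> (j \<otimes> l)" using prod lc assms fracE(4) m_assoc by metis
    then show ?case using prod l by (metis ideal_prod.prod)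
  next
    case (sum s1 s2)
    have "s1 \<in> carrier K" "s2 \<in> carrier K"
      using sum frac_prod[OF assms(1,2)] fracE(4) by blast+
    then have "(s1 \<oplus> s2) \<otimes> l = s1 \<otimes> l \<oplus> s2 \<otimes> l" using lc by (rule l_distr)
    then show ?case using sum submoduleE(3)[OF s] by metis
  qed
qed

text \<open>The missing inclusion is \<open>prod_assoc_le\<close> with the three factors in reverse
  order, by commutativity.\<close>

lemma prod_assoc:
  assumes "fractional M" "fractional N" "fractional L"
  shows "(M \<cdot> N) \<cdot> L = M \<cdot> (N \<cdot> L)"
proof
  have "M \<cdot> (N \<cdot> L) = (L \<cdot> N) \<cdot> M"
    using assms frac_prod prod_comm by metis
  also have "\<dots> \<subseteq> L \<cdot> (N \<cdot> M)" by (rule prod_assoc_le[OF assms(3,2,1)])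
  also have "\<dots> = (M \<cdot> N) \<cdot> L" using assms frac_prod prod_comm by metis
  finally show "M \<cdot> (N \<cdot> L) \<subseteq> (M \<cdot> N) \<cdot> L" .
qed (rule prod_assoc_le[OF assms])

lemma prod_left_comm:
  assumes "fractional M" "fractional N" "fractional L"
  shows "M \<cdot> (N \<cdot> L) = N \<cdot> (M \<cdot> L)"
  using assms prod_assoc prod_comm by metis

lemma D_prod:
  assumes "fractional M"
  shows "D \<cdot> M = M" "M \<cdot> D = M"
proof -
  note s = fracE(1)[OF assms]
  show 1: "D \<cdot> M = M"
  proof
    show "D \<cdot> M \<subseteq> M" using prod_le[OF s] submoduleE(4)[OF s] by blast
    show "M \<subseteq> D \<cdot> M"
    proof
      fix x assume x: "x \<in> M"
      have "\<one> \<otimes> x \<in> D \<cdot> M" using x by (intro ideal_prod.prod) auto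
      then show "x \<in> D \<cdot> M" using x submoduleE(1)[OF s] by simp
    qed
  qed
  then show "M \<cdot> D = M" using prod_comm assms frac_D by metis
qed

lemma prod_inv_le: "fractional M \<Longrightarrow> M \<cdot> inv_ideal M \<subseteq> D"
  by (intro prod_le submodule_D) (metis ideal_invD m_comm fracE(4))

text \<open>The inverse is the largest fractional ideal that multiplies \<open>M\<close> into
  \<open>D\<close>; this is how inverses are bounded from below later.\<close>

lemma le_ideal_inv:
  assumes "fractional M" "fractional N" "M \<cdot> N \<subseteq> D"
  shows "N \<subseteq> inv_ideal M"
proof
  fix n assume n: "n \<in> N"
  have "n \<otimes> m \<in> D" if "m \<in> M" for m
    using ideal_prod.prod[of m M n N K] m_comm[of m n] that n assms fracE(4) by auto
  then show "n \<in> inv_ideal M" using n assms fracE(4) by (auto simp: ideal_inv_def)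
qed

lemma one_in_ideal_inv: "fractional M \<Longrightarrow> M \<subseteq> D \<Longrightarrow> \<one> \<in> inv_ideal M"
  by (auto simp: ideal_inv_def fracE(4))

section \<open>Principal fractional ideals\<close>

lemma submodule_multiples: "x \<in> carrier K \<Longrightarrow> submodule_of K D (multiples x)"
proof (rule submoduleI)
  assume x: "x \<in> carrier K"
  show "multiples x \<subseteq> carrier K" using x D_carr by (auto simp: multiples_def)
  have "\<zero> = \<zero> \<otimes> x" using x by simp
  then show "\<zero> \<in> multiples x" unfolding multiples_def by (metis D_closed(1) imageI)
  show "y \<oplus> z \<in> multiples x" if "y \<in> multiples x" "z \<in> multiples x" for y z
  proof -
    obtain d e where "d \<in> D" "e \<in> D" "y = d \<otimes> x" "z = e \<otimes> x"
      using \<open>y \<in> _\<close> \<open>z \<in> _\<close> by (auto simp: multiples_def)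
    then have "y \<oplus> z = (d \<oplus> e) \<otimes> x" "d \<oplus> e \<in> D" using x by (auto simp: l_distr D_carr)
    then show ?thesis by (auto simp: multiples_def)
  qed
  show "d \<otimes> y \<in> multiples x" if "d \<in> D" "y \<in> multiples x" for d y
  proof -
    obtain e where "e \<in> D" "y = e \<otimes> x" using \<open>y \<in> _\<close> by (auto simp: multiples_def)
    then have "d \<otimes> y = (d \<otimes> e) \<otimes> x" "d \<otimes> e \<in> D" using x that by (auto simp: m_assoc D_carr)
    then show ?thesis by (auto simp: multiples_def)
  qed
qed

lemma multiples_self: "x \<in> carrier K \<Longrightarrow> x \<in> multiples x"
  unfolding multiples_def using D_closed(2) l_one by (metis imageI)

lemma multiples_le: "submodule_of K D M \<Longrightarrow> x \<in> M \<Longrightarrow> multiples x \<subseteq> M"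
  using submoduleE(4) by (auto simp: multiples_def)

lemma frac_multiples:
  assumes "x \<in> carrier K" "x \<noteq> \<zero>"
  shows "fractional (multiples x)"
proof -
  obtain d where d: "d \<in> D" "d \<noteq> \<zero>" "d \<otimes> x \<in> D" using common_denominator[OF assms(1)] .
  show ?thesis
  proof (rule fracI[OF submodule_multiples[OF assms(1)] multiples_self[OF assms(1)] assms(2) d(1,2)])
    fix y assume "y \<in> multiples x"
    then obtain e where "e \<in> D" "y = e \<otimes> x" by (auto simp: multiples_def)
    then have "d \<otimes> y = e \<otimes> (d \<otimes> x)" using d assms(1) by (auto simp: m_ac D_carr)
    then show "d \<otimes> y \<in> D" using d \<open>e \<in> D\<close> by simp
  qed
qed

lemma multiples_prod:
  assumes "x \<in> carrier K" "y \<in> carrier K"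
  shows "multiples x \<cdot> multiples y = multiples (x \<otimes> y)"
proof
  show "multiples x \<cdot> multiples y \<subseteq> multiples (x \<otimes> y)"
  proof (rule prod_le)
    show "submodule_of K D (multiples (x \<otimes> y))" using assms by (intro submodule_multiples) auto
    fix m n assume "m \<in> multiples x" "n \<in> multiples y"
    then obtain d e where "d \<in> D" "e \<in> D" "m = d \<otimes> x" "n = e \<otimes> y" by (auto simp: multiples_def)
    then have "m \<otimes> n = (d \<otimes> e) \<otimes> (x \<otimes> y)" "d \<otimes> e \<in> D" using assms by (auto simp: m_ac D_carr)
    then show "m \<otimes> n \<in> multiples (x \<otimes> y)" by (auto simp: multiples_def)
  qed
  show "multiples (x \<otimes> y) \<subseteq> multiples x \<cdot> multiples y"
    using assms by (intro multiples_le submodule_prod submodule_multiples ideal_prod.prod multiples_self)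
qed

lemma multiples_one: "multiples \<one> = D"
  unfolding multiples_def using D_carr by (auto simp: image_iff)

lemma ideal_inv_multiples:
  assumes "x \<in> carrier K" "x \<noteq> \<zero>"
  shows "inv_ideal (multiples x) = multiples (inv x)"
proof
  note i = inv_facts[OF assms]
  show "multiples (inv x) \<subseteq> inv_ideal (multiples x)"
    using assms i multiples_prod[of x "inv x"] multiples_one
    by (intro le_ideal_inv frac_multiples) auto
  show "inv_ideal (multiples x) \<subseteq> multiples (inv x)"
  proof
    fix y assume y: "y \<in> inv_ideal (multiples x)"
    then have yx: "y \<otimes> x \<in> D" and yc: "y \<in> carrier K"
      using ideal_invD multiples_self assms by blast+
    have "y = (y \<otimes> x) \<otimes> inv x" using yc i assms by (simp add: m_assoc)
    then show "y \<in> multiples (inv x)" using yx by (auto simp: multiples_def)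
  qed
qed

end

subsection \<open>The v- and t-closure\<close>

context quotient_field
begin

lemma v_subset: "F \<subseteq> carrier K \<Longrightarrow> F \<subseteq> v_cl F"
  unfolding v_closure_def ideal_inv_def using m_comm by (auto simp: subset_iff)

lemma v_mono: "F \<subseteq> G \<Longrightarrow> v_cl F \<subseteq> v_cl G"
  unfolding v_closure_def by (intro ideal_inv_antimono)

lemma ideal_inv_carrier: "inv_ideal F \<subseteq> carrier K"
  by (auto simp: ideal_inv_def)

text \<open>\<open>ideal_inv\<close> forms an antitone Galois connection with itself, so three
  applications collapse to one.\<close>

lemma ideal_inv_v_closure: "F \<subseteq> carrier K \<Longrightarrow> inv_ideal (v_cl F) = inv_ideal F"
proof
  assume F: "F \<subseteq> carrier K"
  show "inv_ideal (v_cl F) \<subseteq> inv_ideal F" using v_subset[OF F] by (rule ideal_inv_antimono)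
  show "inv_ideal F \<subseteq> inv_ideal (v_cl F)"
    using v_subset[OF ideal_inv_carrier] by (simp add: v_closure_def)
qed

lemma v_least: "F \<subseteq> v_cl G \<Longrightarrow> G \<subseteq> carrier K \<Longrightarrow> v_cl F \<subseteq> v_cl G"
proof -
  assume F: "F \<subseteq> v_cl G" and G: "G \<subseteq> carrier K"
  have "inv_ideal G \<subseteq> inv_ideal F"
    using ideal_inv_antimono[OF F] ideal_inv_v_closure[OF G] by simp
  then show "v_cl F \<subseteq> v_cl G" unfolding v_closure_def by (rule ideal_inv_antimono)
qed

lemma submodule_v_closure: "submodule_of K D (v_cl F)"
  unfolding v_closure_def by (intro submodule_ideal_inv ideal_inv_carrier)

text \<open>For fixed \<open>x\<close> the elements that \<open>x\<close> multiplies into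
  \<open>D\<close> form a submodule, so testing the generators is enough. Hence a finitely generated
  ideal and its generating set have the same v-closure.\<close>

lemma ideal_inv_Span:
  assumes "set us \<subseteq> carrier K"
  shows "inv_ideal (Span D us) = inv_ideal (set us)"
proof
  show "inv_ideal (Span D us) \<subseteq> inv_ideal (set us)"
    by (intro ideal_inv_antimono Span_incl assms)
  show "inv_ideal (set us) \<subseteq> inv_ideal (Span D us)"
  proof
    fix x assume x: "x \<in> inv_ideal (set us)"
    then have xc: "x \<in> carrier K" using ideal_invD by blast
    have "set us \<subseteq> inv_ideal {x}"
      using x assms by (auto simp: ideal_inv_def m_comm[of _ x])
    then have "Span D us \<subseteq> inv_ideal {x}"
      using xc by (intro Span_least submodule_ideal_inv) auto
    then show "x \<in> inv_ideal (Span D us)" using xc by (auto simp: ideal_inv_def m_comm)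
  qed
qed

text \<open>Finitely generated subideals are replaced by finite subsets, which are far easier to
  unite and to multiply. The nonzero element of \<open>F\<close> encodes that the generated ideal is
  nonzero.\<close>

lemma t_closure_iff:
  assumes "fractional M"
  shows "x \<in> t_cl M \<longleftrightarrow> (\<exists>F. finite F \<and> F \<subseteq> M \<and> (\<exists>u \<in> F. u \<noteq> \<zero>) \<and> x \<in> v_cl F)"
proof
  assume "x \<in> t_cl M"
  then obtain J us where J: "x \<in> v_cl J" "J \<subseteq> M" "fractional J" "set us \<subseteq> carrier K" "J = Span D us"
    unfolding t_closure_def finitely_generated_def by blast
  have "v_cl J = v_cl (set us)" unfolding v_closure_def J(5) ideal_inv_Span[OF J(4)] ..
  moreover have "\<exists>u \<in> set us. u \<noteq> \<zero>"
  proof (rule ccontr)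
    assume "\<not> ?thesis"
    then have "set us \<subseteq> {\<zero>}" by auto
    then have "J \<subseteq> {\<zero>}" unfolding J(5)
      by (intro Span_least submoduleI) (auto dest: D_carr)
    then show False using fracE(2)[OF J(3)] by auto
  qed
  ultimately show "\<exists>F. finite F \<and> F \<subseteq> M \<and> (\<exists>u \<in> F. u \<noteq> \<zero>) \<and> x \<in> v_cl F"
    using J Span_incl[OF J(4)] by (intro exI[of _ "set us"]) auto
next
  assume "\<exists>F. finite F \<and> F \<subseteq> M \<and> (\<exists>u \<in> F. u \<noteq> \<zero>) \<and> x \<in> v_cl F"
  then obtain F u where F: "finite F" "F \<subseteq> M" "u \<in> F" "u \<noteq> \<zero>" "x \<in> v_cl F" by blast
  obtain us where us: "set us = F" using finite_list[OF F(1)] by blast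
  have Fc: "set us \<subseteq> carrier K" using F us fracE(4)[OF assms] by blast
  have le: "Span D us \<subseteq> M" using Span_least[OF fracE(1)[OF assms]] F us by auto
  have "u \<in> Span D us" using Span_incl[OF Fc] F us by auto
  then have "fractional (Span D us)"
    using frac_subset[OF submodule_Span[OF Fc] assms le _ F(4)] by simp
  moreover have "v_cl (Span D us) = v_cl F" unfolding v_closure_def ideal_inv_Span[OF Fc] us ..
  ultimately show "x \<in> t_cl M"
    unfolding t_closure_def finitely_generated_def using le Fc F(5) by blast
qed

lemma t_closure_le_v:
  assumes "fractional M"
  shows "t_cl M \<subseteq> v_cl M"
  unfolding t_closure_iff[OF assms] subset_iff[of "t_cl M"] using v_mono[of _ M] by blast

lemma t_extensive:
  assumes "fractional M"
  shows "M \<subseteq> t_cl M"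
proof
  fix x assume x: "x \<in> M"
  \<comment> \<open>Since \<open>x\<close> may be zero, a nonzero companion is put into the finite
    set.\<close>
  obtain m where m: "m \<in> M" "m \<noteq> \<zero>" using fracE(2)[OF assms] by blast
  have "{x, m} \<subseteq> carrier K" using x m fracE(4)[OF assms] by blast
  then have "x \<in> v_cl {x, m}" using v_subset by blast
  then show "x \<in> t_cl M" unfolding t_closure_iff[OF assms]
    using x m by (intro exI[of _ "{x, m}"]) auto
qed

lemma frac_t:
  assumes "fractional M"
  shows "fractional (t_cl M)"
proof -
  obtain m where m: "m \<in> M" "m \<noteq> \<zero>" using fracE(2)[OF assms] by blast
  obtain d where d: "d \<in> D" "d \<noteq> \<zero>" "\<forall>x \<in> M. d \<otimes> x \<in> D" using fracE(3)[OF assms] by blast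
  have mt: "m \<in> t_cl M" using t_extensive[OF assms] m by auto
  have v: "t_cl M \<subseteq> v_cl M" by (rule t_closure_le_v[OF assms])
  note V = submoduleE[OF submodule_v_closure]
  have sub: "submodule_of K D (t_cl M)"
  proof (rule submoduleI)
    show "t_cl M \<subseteq> carrier K" using v V(1) by blast
    have "\<zero> \<in> v_cl {m}" by (rule V(2))
    then show "\<zero> \<in> t_cl M" unfolding t_closure_iff[OF assms]
      using m by (intro exI[of _ "{m}"]) auto
  next
    fix x y assume "x \<in> t_cl M" "y \<in> t_cl M"
    then obtain F G where F: "finite F" "F \<subseteq> M" "\<exists>u\<in>F. u \<noteq> \<zero>" "x \<in> v_cl F"
      and G: "finite G" "G \<subseteq> M" "y \<in> v_cl G" unfolding t_closure_iff[OF assms] by blast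
    have "x \<oplus> y \<in> v_cl (F \<union> G)"
      using V(3) v_mono[of F "F \<union> G"] v_mono[of G "F \<union> G"] F G by blast
    then show "x \<oplus> y \<in> t_cl M" unfolding t_closure_iff[OF assms]
      using F G by (intro exI[of _ "F \<union> G"]) auto
  next
    fix d x assume "d \<in> D" "x \<in> t_cl M"
    then show "d \<otimes> x \<in> t_cl M" using V(4) unfolding t_closure_iff[OF assms] by blast
  qed
  show ?thesis
  proof (rule fracI[OF sub mt m(2) d(1,2)])
    fix x assume "x \<in> t_cl M"
    then have x: "x \<in> v_cl M" using v by blast
    \<comment> \<open>A denominator of \<open>M\<close> lies in its inverse, which the v-closure
      multiplies into \<open>D\<close>; so the same \<open>d\<close> serves for the
      t-closure.\<close>
    have "d \<in> inv_ideal M" using d D_carr by (auto simp: ideal_inv_def)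
    then have "x \<otimes> d \<in> D" using x unfolding v_closure_def by (rule ideal_invD(1)[rotated])
    then show "d \<otimes> x \<in> D" using m_comm D_carr[OF d(1)] V(1)[OF x] by metis
  qed
qed

lemma t_mono:
  assumes "fractional M" "fractional N" "M \<subseteq> N"
  shows "t_cl M \<subseteq> t_cl N"
  using assms(3) unfolding subset_iff t_closure_iff[OF assms(1)] t_closure_iff[OF assms(2)] by blast

text \<open>Each of the finitely many elements of \<open>F\<close> is already in the v-closure of a
  finite part of \<open>M\<close>. The union of these parts is finite, and its v-closure contains
  that of \<open>F\<close>.\<close>

lemma t_idem:
  assumes "fractional M"
  shows "t_cl (t_cl M) = t_cl M"
proof
  show "t_cl M \<subseteq> t_cl (t_cl M)" using assms frac_t t_extensive by blast
  show "t_cl (t_cl M) \<subseteq> t_cl M"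
  proof
    fix x assume "x \<in> t_cl (t_cl M)"
    then obtain F where F: "finite F" "F \<subseteq> t_cl M" "\<exists>u\<in>F. u \<noteq> \<zero>" "x \<in> v_cl F"
      unfolding t_closure_iff[OF frac_t[OF assms]] by blast
    have "\<forall>y\<in>F. \<exists>G. finite G \<and> G \<subseteq> M \<and> (\<exists>u \<in> G. u \<noteq> \<zero>) \<and> y \<in> v_cl G"
      using F(2) t_closure_iff[OF assms] by blast
    then obtain G where G: "\<And>y. y \<in> F \<Longrightarrow> finite (G y) \<and> G y \<subseteq> M \<and> (\<exists>u \<in> G y. u \<noteq> \<zero>) \<and> y \<in> v_cl (G y)"
      by metis
    define H where "H = (\<Union>y\<in>F. G y)"
    have H: "finite H" "H \<subseteq> M" "\<exists>u\<in>H. u \<noteq> \<zero>" using F G unfolding H_def by auto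
    have Hc: "H \<subseteq> carrier K" using H fracE(4)[OF assms] by blast
    have "F \<subseteq> v_cl H" using G v_mono[of _ H] unfolding H_def by blast
    then have "x \<in> v_cl H" using v_least[OF _ Hc] F by blast
    then show "x \<in> t_cl M" unfolding t_closure_iff[OF assms] using H by blast
  qed
qed

text \<open>If \<open>y\<close> is in the inverse of the scaled set, then
  \<open>n \<otimes> y\<close> is in the inverse of \<open>F\<close>, which \<open>x\<close>
  multiplies into \<open>D\<close>.\<close>

lemma v_closure_mult:
  assumes "x \<in> v_cl F" "n \<in> carrier K" "F \<subseteq> carrier K"
  shows "x \<otimes> n \<in> v_cl ((\<lambda>f. f \<otimes> n) ` F)"
proof -
  have xc: "x \<in> carrier K" using submoduleE(1)[OF submodule_v_closure] assms(1) .
  have "x \<otimes> n \<otimes> y \<in> D" if y: "y \<in> inv_ideal ((\<lambda>f. f \<otimes> n) ` F)" for y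
  proof -
    have yc: "y \<in> carrier K" using y ideal_invD by blast
    have "n \<otimes> y \<otimes> f \<in> D" if "f \<in> F" for f
    proof -
      have "n \<otimes> y \<otimes> f = y \<otimes> (f \<otimes> n)" using assms that yc by (auto simp: m_ac subset_iff)
      then show ?thesis using y that ideal_invD(1)[of y "(\<lambda>f. f \<otimes> n) ` F" "f \<otimes> n"] by auto
    qed
    then have "n \<otimes> y \<in> inv_ideal F" using assms yc by (auto simp: ideal_inv_def)
    then have "x \<otimes> (n \<otimes> y) \<in> D" using assms(1) unfolding v_closure_def by (rule ideal_invD(1)[rotated])
    then show ?thesis using xc yc assms by (simp add: m_assoc)
  qed
  then show ?thesis using xc assms unfolding v_closure_def by (subst ideal_inv_def) auto
qed

lemma t_mult:
  assumes "fractional M" "fractional N"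
  shows "t_cl M \<cdot> N \<subseteq> t_cl (M \<cdot> N)"
proof (rule prod_le)
  note MN = frac_prod[OF assms]
  show sub: "submodule_of K D (t_cl (M \<cdot> N))" using frac_t[OF MN] fracE(1) by blast
  fix x n assume x: "x \<in> t_cl M" and n: "n \<in> N"
  have xc: "x \<in> carrier K" using x frac_t[OF assms(1)] fracE(4) by blast
  have nc: "n \<in> carrier K" using n assms fracE(4) by blast
  \<comment> \<open>Scaling by a nonzero \<open>n\<close> keeps a nonzero element in the finite set.
    For \<open>n = \<zero>\<close> the scaled set has none, and the product is zero anyway.\<close>
  show "x \<otimes> n \<in> t_cl (M \<cdot> N)"
  proof (cases "n = \<zero>")
    case True
    then show ?thesis using submoduleE(2)[OF sub] xc by simp
  next
    case False
    obtain F u where F: "finite F" "F \<subseteq> M" "u \<in> F" "u \<noteq> \<zero>" "x \<in> v_cl F"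
      using x unfolding t_closure_iff[OF assms(1)] by blast
    have Fc: "F \<subseteq> carrier K" using F fracE(4)[OF assms(1)] by blast
    have "u \<otimes> n \<noteq> \<zero>" using False F nc Fc integral_iff[of u n] by auto
    moreover have "(\<lambda>f. f \<otimes> n) ` F \<subseteq> M \<cdot> N" using F n by (auto intro: ideal_prod.prod)
    ultimately show ?thesis unfolding t_closure_iff[OF MN]
      using v_closure_mult[OF F(5) nc Fc] F by (intro exI[of _ "(\<lambda>f. f \<otimes> n) ` F"]) auto
  qed
qed

lemma v_closure_D: "v_cl D = D"
  by (simp add: v_closure_def ideal_inv_D)

lemma t_closure_D: "t_cl D = D"
  using t_extensive[OF frac_D] t_closure_le_v[OF frac_D] v_closure_D by auto

text \<open>An inverse is its own v-closure, and the t-closure lies between an ideal and its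
  v-closure.\<close>

lemma t_closure_ideal_inv:
  assumes "F \<subseteq> carrier K" "fractional (inv_ideal F)"
  shows "t_cl (inv_ideal F) = inv_ideal F"
  using t_extensive[OF assms(2)] t_closure_le_v[OF assms(2)] ideal_inv_v_closure[OF assms(1)]
  by (auto simp: v_closure_def)

end

subsection \<open>Star operations\<close>

text \<open>The customary axiom on principal ideals is expressed by \<open>c_mult\<close> together
  with \<open>c_D\<close>; that principal ideals are closed is recovered in
  \<open>star_invertible_multiples\<close>.\<close>

locale star_operation = quotient_field K D for K (structure) and D +
  fixes c :: "'a set \<Rightarrow> 'a set"
  assumes c_frac: "fractional M \<Longrightarrow> fractional (c M)"
    and c_extensive: "fractional M \<Longrightarrow> M \<subseteq> c M"
    and c_mono: "fractional M \<Longrightarrow> fractional N \<Longrightarrow> M \<subseteq> N \<Longrightarrow> c M \<subseteq> c N"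
    and c_idem: "fractional M \<Longrightarrow> c (c M) = c M"
    and c_mult: "fractional M \<Longrightarrow> fractional N \<Longrightarrow> c M \<cdot> N \<subseteq> c (M \<cdot> N)"
    and c_D: "c D = D"
begin

definition star_invertible :: "'a set \<Rightarrow> bool"
  where "star_invertible M \<longleftrightarrow> fractional M \<and> c (M \<cdot> inv_ideal M) = D"

lemma c_least: "fractional M \<Longrightarrow> fractional N \<Longrightarrow> M \<subseteq> c N \<Longrightarrow> c M \<subseteq> c N"
  using c_mono[of M "c N"] c_frac c_idem by auto

lemma c_le_D: "fractional M \<Longrightarrow> M \<subseteq> D \<Longrightarrow> c M \<subseteq> D"
  using c_mono[OF _ frac_D] c_D by auto

lemma c_prod_left:
  assumes "fractional M" "fractional N"
  shows "c (c M \<cdot> N) = c (M \<cdot> N)"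
proof
  show "c (c M \<cdot> N) \<subseteq> c (M \<cdot> N)"
    using assms by (intro c_least c_mult frac_prod c_frac)
  show "c (M \<cdot> N) \<subseteq> c (c M \<cdot> N)"
    using assms by (intro c_mono prod_le_prod c_extensive frac_prod c_frac) auto
qed

lemma c_prod_right:
  assumes "fractional M" "fractional N"
  shows "c (M \<cdot> c N) = c (M \<cdot> N)"
  using c_prod_left[OF assms(2,1)] prod_comm[OF assms] prod_comm[OF assms(1) c_frac[OF assms(2)]]
  by simp

text \<open>Any inverse up to closure is contained in \<open>inv_ideal M\<close>, so the latter
  reaches \<open>D\<close> as well, while its product with \<open>M\<close> never exceeds
  \<open>D\<close>.\<close>

lemma star_invertibleI:
  assumes "fractional M" "fractional N" "c (M \<cdot> N) = D"
  shows "star_invertible M"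
proof -
  have "N \<subseteq> inv_ideal M"
    using le_ideal_inv[OF assms(1,2)] c_extensive[OF frac_prod[OF assms(1,2)]] assms(3) by simp
  then have "c (M \<cdot> N) \<subseteq> c (M \<cdot> inv_ideal M)"
    using assms(1,2) by (intro c_mono prod_le_prod frac_prod frac_ideal_inv) auto
  with assms(3) have "D \<subseteq> c (M \<cdot> inv_ideal M)" by simp
  then show ?thesis
    unfolding star_invertible_def
    using assms(1) c_le_D[OF _ prod_inv_le] frac_prod frac_ideal_inv by blast
qed

lemma star_invertible_c:
  assumes "fractional M"
  shows "star_invertible (c M) \<longleftrightarrow> star_invertible M"
proof
  assume "star_invertible (c M)"
  then have "c (c M \<cdot> inv_ideal (c M)) = D" by (simp add: star_invertible_def)
  moreover have i: "fractional (inv_ideal (c M))" by (intro frac_ideal_inv c_frac assms)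
  ultimately show "star_invertible M"
    using c_prod_left[OF assms i] by (intro star_invertibleI[OF assms i]) simp
next
  assume "star_invertible M"
  then have "c (M \<cdot> inv_ideal M) = D" by (simp add: star_invertible_def)
  moreover have i: "fractional (inv_ideal M)" by (intro frac_ideal_inv assms)
  ultimately show "star_invertible (c M)"
    using c_prod_left[OF assms i] by (intro star_invertibleI[OF c_frac[OF assms] i]) simp
qed

text \<open>By \<open>c_mult\<close> the closure of the inverse still multiplies \<open>M\<close>
  into \<open>D\<close>, and the inverse is the largest ideal to do so.\<close>

lemma c_ideal_inv:
  assumes "fractional M"
  shows "c (inv_ideal M) = inv_ideal M"
proof
  note i = frac_ideal_inv[OF assms]
  show "inv_ideal M \<subseteq> c (inv_ideal M)" by (rule c_extensive[OF i])
  have "c (inv_ideal M) \<cdot> M \<subseteq> c (inv_ideal M \<cdot> M)" by (rule c_mult[OF i assms])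
  also have "\<dots> \<subseteq> D"
    using c_le_D frac_prod[OF assms i] prod_inv_le[OF assms] prod_comm[OF assms i] by metis
  finally show "c (inv_ideal M) \<subseteq> inv_ideal M"
    using prod_comm[OF assms c_frac[OF i]] by (intro le_ideal_inv assms c_frac i) simp
qed

lemma star_invertible_prod:
  assumes "star_invertible M" "star_invertible N"
  shows "star_invertible (M \<cdot> N)"
proof -
  have f: "fractional M" "fractional N" using assms star_invertible_def by auto
  note i = frac_ideal_inv[OF f(1)] frac_ideal_inv[OF f(2)]
  have "(M \<cdot> N) \<cdot> (inv_ideal M \<cdot> inv_ideal N) = (M \<cdot> inv_ideal M) \<cdot> (N \<cdot> inv_ideal N)"
    using f i by (simp add: prod_assoc prod_left_comm frac_prod)
  then have "c ((M \<cdot> N) \<cdot> (inv_ideal M \<cdot> inv_ideal N)) = c (D \<cdot> (N \<cdot> inv_ideal N))"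
    using c_prod_left[OF frac_prod[OF f(1) i(1)] frac_prod[OF f(2) i(2)]] assms(1)
    by (simp add: star_invertible_def)
  also have "\<dots> = D"
    using D_prod(1)[OF frac_prod[OF f(2) i(2)]] assms(2) by (simp add: star_invertible_def)
  finally show ?thesis by (intro star_invertibleI[OF frac_prod[OF f] frac_prod[OF i]])
qed

text \<open>Multiply by the inverse of \<open>A\<close> and close. It will show that a division
  which leaves \<open>A\<close> unchanged was a division by \<open>D\<close>.\<close>

lemma star_invertible_cancel:
  assumes "star_invertible A" "fractional N" "c (A \<cdot> N) = c A"
  shows "c N = D"
proof -
  have f: "fractional A" "c (A \<cdot> inv_ideal A) = D" using assms by (auto simp: star_invertible_def)
  note i = frac_ideal_inv[OF f(1)]
  have "D = c (c (A \<cdot> N) \<cdot> inv_ideal A)"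
    using f c_prod_left[OF f(1) i] assms(3) by simp
  also have "\<dots> = c ((A \<cdot> N) \<cdot> inv_ideal A)" by (intro c_prod_left frac_prod f assms i)
  also have "(A \<cdot> N) \<cdot> inv_ideal A = N \<cdot> (A \<cdot> inv_ideal A)"
    using prod_assoc[OF f(1) assms(2) i] prod_left_comm[OF f(1) assms(2) i] by simp
  also have "c \<dots> = c (N \<cdot> D)" using c_prod_right[OF assms(2) frac_prod[OF f(1) i]] f(2) by simp
  finally show ?thesis using D_prod(2)[OF assms(2)] by simp
qed

lemma star_invertible_inv:
  assumes "star_invertible M"
  shows "star_invertible (inv_ideal M)"
proof -
  have f: "fractional M" "c (M \<cdot> inv_ideal M) = D" using assms by (auto simp: star_invertible_def)
  note i = frac_ideal_inv[OF f(1)]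
  show ?thesis using f(2) prod_comm[OF f(1) i] by (intro star_invertibleI[OF i f(1)]) simp
qed

text \<open>Closedness holds because \<open>multiples x\<close> is the inverse of
  \<open>multiples (inv x)\<close>, and inverses are closed.\<close>

lemma star_invertible_multiples:
  assumes "x \<in> carrier K" "x \<noteq> \<zero>"
  shows "star_invertible (multiples x)" "c (multiples x) = multiples x"
proof -
  note i = inv_facts[OF assms]
  have "star_invertible (multiples y)" if "y \<in> carrier K" "y \<noteq> \<zero>" for y
    unfolding star_invertible_def ideal_inv_multiples[OF that]
    using that inv_facts[OF that] frac_multiples multiples_prod multiples_one c_D by auto
  then show "star_invertible (multiples x)" using assms by blast
  have "inv_ideal (multiples (inv x)) = multiples (inv (inv x))"
    using i by (intro ideal_inv_multiples) auto
  moreover have "inv (inv x) = x" using assms field_Units by (intro Units_inv_inv) auto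
  ultimately show "c (multiples x) = multiples x"
    using c_ideal_inv[OF frac_multiples[OF i(1,4)]] by simp
qed

text \<open>If \<open>x \<otimes> I \<subseteq> I\<close>, then \<open>x\<close> multiplies \<open>I I\<^sup>-\<^sup>1\<close>, hence its closure \<open>D\<close>, into itself.\<close>

lemma multiplier_in_D:
  assumes "star_invertible I" "x \<in> carrier K" "\<And>i. i \<in> I \<Longrightarrow> x \<otimes> i \<in> I"
  shows "x \<in> D"
proof (cases "x = \<zero>")
  case False
  have f: "fractional I" using assms star_invertible_def by auto
  note i = frac_ideal_inv[OF f] frac_multiples[OF assms(2) False]
  have "multiples x \<cdot> I \<subseteq> I"
  proof (rule prod_le[OF fracE(1)[OF f]])
    fix m n assume m: "m \<in> multiples x" and n: "n \<in> I"
    then obtain d where d: "d \<in> D" "m = d \<otimes> x" by (auto simp: multiples_def)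
    have "m \<otimes> n = d \<otimes> (x \<otimes> n)" using d n assms(2) fracE(4)[OF f] by (simp add: m_assoc D_carr)
    then show "m \<otimes> n \<in> I" using assms(3)[OF n] submoduleE(4)[OF fracE(1)[OF f] d(1)] by simp
  qed
  then have "(multiples x \<cdot> I) \<cdot> inv_ideal I \<subseteq> D"
    using prod_le_prod[of _ I "inv_ideal I" "inv_ideal I"] prod_inv_le[OF f] by blast
  then have "multiples x \<cdot> (I \<cdot> inv_ideal I) \<subseteq> D" using prod_assoc f i by metis
  then have "c (multiples x \<cdot> (I \<cdot> inv_ideal I)) \<subseteq> D" using c_le_D frac_prod f i by metis
  then have "c (multiples x \<cdot> D) \<subseteq> D"
    using assms(1) c_prod_right f i frac_prod unfolding star_invertible_def by metis
  then have "multiples x \<subseteq> D" using D_prod(2)[OF i(2)] c_extensive[OF i(2)] by simp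
  then show ?thesis using multiples_self[OF assms(2)] by blast
qed simp

text \<open>The elements of \<open>D\<close> that multiply every power of \<open>x\<close> into
  \<open>D\<close> form an ideal \<open>I\<close>, nonzero because of \<open>d\<close>.
  Multiplication by \<open>x\<close> only shifts the powers, so it maps \<open>I\<close> into
  itself.\<close>

lemma completely_integrally_closed:
  assumes inv: "\<And>I. fractional I \<Longrightarrow> I \<subseteq> D \<Longrightarrow> star_invertible I"
    and d: "d \<in> D" "d \<noteq> \<zero>" and x: "x \<in> carrier K" and dx: "\<And>n::nat. d \<otimes> x [^] n \<in> D"
  shows "x \<in> D"
proof -
  define I where "I = {e \<in> D. \<forall>n::nat. e \<otimes> x [^] n \<in> D}"
  have "submodule_of K D I"
    using x by (intro submoduleI) (auto simp: I_def D_carr l_distr m_assoc)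
  moreover have "I \<subseteq> D" by (auto simp: I_def)
  moreover have "d \<in> I" using d dx by (auto simp: I_def)
  ultimately have "fractional I" using frac_subset[OF _ frac_D] d by blast
  then have "star_invertible I" using inv \<open>I \<subseteq> D\<close> by simp
  then show ?thesis
  proof (rule multiplier_in_D[OF _ x])
    fix e assume e: "e \<in> I"
    have "x \<otimes> e \<otimes> x [^] n \<in> D" for n :: nat
    proof -
      have "x \<otimes> e \<otimes> x [^] n = e \<otimes> x [^] Suc n" using x e by (auto simp: I_def m_ac D_carr)
      moreover have "e \<otimes> x [^] Suc n \<in> D" using e unfolding I_def by blast
      ultimately show ?thesis by simp
    qed
    moreover have "x \<otimes> e \<in> D" using calculation[of 0] x e D_carr by (auto simp: I_def)
    ultimately show "x \<otimes> e \<in> I" by (auto simp: I_def)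
  qed
qed

end

section \<open>The identity and the t-closure as star operations; t-ACC as a maximum
  condition\<close>

context quotient_field
begin

lemma star_operation_id: "star_operation K D (\<lambda>M. M)"
  by unfold_locales auto

lemma star_operation_t: "star_operation K D t_cl"
  by unfold_locales
    (use frac_t t_extensive t_mono t_idem t_mult t_closure_D in auto)

interpretation d: star_operation K D "\<lambda>M. M" by (rule star_operation_id)
interpretation t: star_operation K D t_cl by (rule star_operation_t)

lemma d_invertible_iff: "d.star_invertible M \<longleftrightarrow> invertible_ideal K D M"
  by (simp add: d.star_invertible_def invertible_ideal_def)

lemma t_invertible_iff: "t.star_invertible M \<longleftrightarrow> t_invertible K D M"
  by (simp add: t.star_invertible_def t_invertible_def)

text \<open>\<open>t_cl M\<close> multiplies the inverse of \<open>M\<close> into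
  \<open>t_cl D = D\<close>; a further multiplication by \<open>M\<close> turns this into
  \<open>t_cl M \<subseteq> M\<close>.\<close>

lemma invertible_imp_t:
  assumes "invertible_ideal K D M"
  shows "t_invertible K D M" "t_ideal K D M"
proof -
  have M: "fractional M" "M \<cdot> inv_ideal M = D" using assms by (auto simp: invertible_ideal_def)
  note i = frac_ideal_inv[OF M(1)] frac_t[OF M(1)]
  show "t_invertible K D M" using M t_closure_D by (simp add: t_invertible_def)
  have "t_cl M \<cdot> inv_ideal M \<subseteq> t_cl (M \<cdot> inv_ideal M)" by (rule t_mult[OF M(1) i(1)])
  then have "(t_cl M \<cdot> inv_ideal M) \<cdot> M \<subseteq> D \<cdot> M"
    using M t_closure_D by (intro prod_le_prod) auto
  moreover have "(t_cl M \<cdot> inv_ideal M) \<cdot> M = t_cl M"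
    using M i prod_assoc prod_comm D_prod by metis
  ultimately have "t_cl M \<subseteq> M" using D_prod(1)[OF M(1)] by simp
  then show "t_ideal K D M" using M t_extensive unfolding t_ideal_def by blast
qed

lemma t_ACC_maximal:
  assumes "t_ACC K D" "A0 \<in> S"
    and S: "\<And>A. A \<in> S \<Longrightarrow> A \<subseteq> D \<and> t_ideal K D A \<and> t_invertible K D A"
  shows "\<exists>A\<in>S. \<forall>B\<in>S. A \<subseteq> B \<longrightarrow> B = A"
proof (rule ccontr)
  assume "\<not> ?thesis"
  then have "\<forall>A\<in>S. \<exists>B\<in>S. A \<subset> B" by blast
  then have "\<exists>J. \<forall>n. J n \<in> S \<and> J n \<subset> J (Suc n)"
    using assms(2) dependent_nat_choice[of "\<lambda>_ A. A \<in> S" "\<lambda>_ A B. A \<subset> B"] by blast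
  then obtain J :: "nat \<Rightarrow> 'a set" where J: "\<And>n. J n \<in> S" "\<And>n. J n \<subset> J (Suc n)" by blast
  have "nonzero_integral_ideal K D (J n) \<and> t_ideal K D (J n) \<and> t_invertible K D (J n)" for n
    using S[OF J(1)] unfolding nonzero_integral_iff by (auto simp: t_ideal_def)
  moreover have "J n \<subseteq> J (Suc n)" for n using J(2) by blast
  ultimately obtain N where N: "\<forall>n\<ge>N. J n = J N" using assms(1) unfolding t_ACC_def by meson
  have "J (Suc N) = J N" by (rule N[rule_format]) simp
  then show False using J(2) by blast
qed

end

section \<open>Division by covering ideals\<close>

context star_operation
begin

text \<open>
  \<open>H\<close> is a group of star-invertible ideals. If some integral ideal is not in \<open>H\<close>, choose
  \<open>A \<in> H\<close> maximal below such an ideal \<open>I\<close>, and \<open>J \<in> H\<close> proper above \<open>I\<close>. Dividing by \<open>J\<close> replaces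
  \<open>(A, I)\<close> by a pair of the same kind with larger \<open>A\<close>, so that \<open>J = D\<close> by cancellation.
\<close>

lemma all_in_group:
  assumes acc: "t_ACC K D"
    and inv: "\<And>A. A \<in> H \<Longrightarrow> star_invertible A \<and> c A = A"
    and mult: "\<And>A B. A \<in> H \<Longrightarrow> B \<in> H \<Longrightarrow> c (A \<cdot> B) \<in> H"
    and inverse: "\<And>A. A \<in> H \<Longrightarrow> inv_ideal A \<in> H"
    and principal: "\<And>x. x \<in> carrier K \<Longrightarrow> x \<noteq> \<zero> \<Longrightarrow> multiples x \<in> H"
    and t: "\<And>A. A \<in> H \<Longrightarrow> t_ideal K D A \<and> t_invertible K D A"
    and cover: "\<And>I. fractional I \<Longrightarrow> I \<subseteq> D \<Longrightarrow> c I = I \<Longrightarrow> I \<noteq> D \<Longrightarrow> \<exists>J\<in>H. I \<subseteq> J \<and> J \<subseteq> D \<and> J \<noteq> D"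
    and I0: "fractional I0" "I0 \<subseteq> D" "c I0 = I0"
  shows "I0 \<in> H"
proof (rule ccontr)
  assume I0': "I0 \<notin> H"
  define S where "S = {A \<in> H. \<exists>I. A \<subseteq> I \<and> fractional I \<and> I \<subseteq> D \<and> c I = I \<and> I \<notin> H}"
  obtain x where x: "x \<in> I0" "x \<noteq> \<zero>" using fracE(2)[OF I0(1)] by blast
  \<comment> \<open>A principal ideal inside \<open>I0\<close> shows that \<open>S\<close> is
    nonempty. Members of \<open>S\<close> come from \<open>H\<close>, so the chain condition applies
    to them though not to the ideals \<open>I\<close> above them.\<close>
  have "multiples x \<in> S"
    unfolding S_def mem_Collect_eq
    using principal[OF fracE(4)[OF I0(1) x(1)] x(2)] multiples_le[OF fracE(1)[OF I0(1)] x(1)]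
      I0 I0' by (intro conjI exI[of _ I0])
  then have "\<exists>A\<in>S. \<forall>B\<in>S. A \<subseteq> B \<longrightarrow> B = A"
    by (rule t_ACC_maximal[OF acc]) (use t in \<open>auto simp: S_def\<close>)
  then obtain A where A: "A \<in> S" and max: "\<And>B. B \<in> S \<Longrightarrow> A \<subseteq> B \<Longrightarrow> B = A" by auto
  then obtain I where AH: "A \<in> H" and I: "A \<subseteq> I" "fractional I" "I \<subseteq> D" "c I = I" "I \<notin> H"
    unfolding S_def by blast
  have "D \<in> H" using principal[of \<one>] multiples_one by simp
  then have "I \<noteq> D" using I(5) by auto
  then obtain J where JH: "J \<in> H" and J: "I \<subseteq> J" "J \<subseteq> D" "J \<noteq> D" using cover[OF I(2-4)] by auto
  have fA: "fractional A" and fJ: "fractional J"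
    and J1: "c (J \<cdot> inv_ideal J) = D" and cJ: "c J = J"
    using inv[OF AH] inv[OF JH] by (auto simp: star_invertible_def)
  define J' where "J' = inv_ideal J"
  have fJ': "fractional J'" unfolding J'_def by (rule frac_ideal_inv[OF fJ])
  have J1: "c (J \<cdot> J') = D" using J1 unfolding J'_def by auto
  note f = fA fJ fJ' I(2)
  have JH': "J' \<in> H" unfolding J'_def by (rule inverse[OF JH])
  have "c (I \<cdot> J') \<subseteq> c (J \<cdot> J')" using f J by (intro c_mono prod_le_prod frac_prod) auto
  then have 1: "c (I \<cdot> J') \<subseteq> D" using J1 by simp
  \<comment> \<open>Multiplying back by \<open>J\<close> recovers \<open>I\<close>, so membership of
    the quotient in \<open>H\<close> would put \<open>I\<close> there too.\<close>
  have 2: "c (I \<cdot> J') \<notin> H"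
  proof
    assume "c (I \<cdot> J') \<in> H"
    then have "c (c (I \<cdot> J') \<cdot> J) \<in> H" using mult JH by blast
    moreover have "c (c (I \<cdot> J') \<cdot> J) = c ((I \<cdot> J') \<cdot> J)" by (intro c_prod_left frac_prod f)
    moreover have "(I \<cdot> J') \<cdot> J = I \<cdot> (J \<cdot> J')"
      using prod_assoc[OF f(4,3,2)] prod_comm[OF f(3,2)] by simp
    moreover have "c (I \<cdot> (J \<cdot> J')) = c (I \<cdot> D)"
      using c_prod_right[OF f(4) frac_prod[OF f(2,3)]] J1 by simp
    ultimately have "c I \<in> H" using D_prod(2)[OF f(4)] by simp
    then show False using I(4,5) by simp
  qed
  have 3: "c (A \<cdot> J') \<subseteq> c (I \<cdot> J')" using f I by (intro c_mono prod_le_prod frac_prod) auto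
  have "c (A \<cdot> J') \<in> S"
    unfolding S_def mem_Collect_eq
    using 1 2 3 mult[OF AH JH'] c_frac[OF frac_prod[OF f(4,3)]] c_idem[OF frac_prod[OF f(4,3)]]
    by (intro conjI exI[of _ "c (I \<cdot> J')"])
  moreover have "A \<subseteq> c (A \<cdot> J')"
  proof -
    \<comment> \<open>As \<open>J\<close> is integral, its inverse contains \<open>D\<close>; hence
      dividing by \<open>J\<close> can only enlarge \<open>A\<close>.\<close>
    have "D \<subseteq> J'" using J unfolding J'_def by (intro le_ideal_inv fJ frac_D) (simp add: D_prod fJ)
    then have "A \<cdot> D \<subseteq> A \<cdot> J'" by (intro prod_le_prod) auto
    then show ?thesis using D_prod(2)[OF f(1)] c_extensive[OF frac_prod[OF f(1,3)]] by simp
  qed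
  ultimately have eq: "c (A \<cdot> J') = A" by (rule max)
  then have "c (A \<cdot> J') = c A" using inv[OF AH] by simp
  then have "c J' = D" by (rule star_invertible_cancel[rotated -1]) (use inv[OF AH] f in auto)
  then have "c (J \<cdot> D) = D" using J1 c_prod_right[OF f(2,3)] by simp
  then show False using D_prod(2)[OF f(2)] cJ J(3) by simp
qed

end

context star_operation
begin

text \<open>The colon ideal \<open>Q = (P : a)\<close> contains \<open>P\<close> and misses
  \<open>\<one>\<close>. It is closed because \<open>c Q\<close> still multiplies \<open>a\<close>
  into \<open>c P = P\<close>. Maximality makes it equal to \<open>P\<close>, and \<open>b\<close>
  belongs to it.\<close>

lemma maximal_star_ideal_prime:
  assumes P: "fractional P" "P \<subseteq> D" "c P = P" "P \<noteq> D"
    and max: "\<And>I. fractional I \<Longrightarrow> I \<subseteq> D \<Longrightarrow> c I = I \<Longrightarrow> I \<noteq> D \<Longrightarrow> P \<subseteq> I \<Longrightarrow> I = P"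
    and ab: "a \<in> D" "b \<in> D" "a \<otimes> b \<in> P" "a \<notin> P"
  shows "b \<in> P"
proof -
  note s = submoduleE[OF fracE(1)[OF P(1)]]
  define Q where "Q = {y \<in> D. a \<otimes> y \<in> P}"
  have a0: "a \<noteq> \<zero>" using ab s(2) by auto
  have sub: "submodule_of K D Q"
  proof (rule submoduleI)
    fix d x assume d: "d \<in> D" and x: "x \<in> Q"
    have "a \<otimes> (d \<otimes> x) = d \<otimes> (a \<otimes> x)" using d x ab by (auto simp: Q_def m_ac D_carr)
    then show "d \<otimes> x \<in> Q" using d x s(4) by (auto simp: Q_def)
  qed (use ab s D_carr in \<open>auto simp: Q_def r_distr\<close>)
  have PQ: "P \<subseteq> Q" using P s(4) ab by (auto simp: Q_def)
  obtain m where "m \<in> P" "m \<noteq> \<zero>" using fracE(2)[OF P(1)] by blast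
  then have f: "fractional Q" using frac_subset[OF sub frac_D] PQ by (auto simp: Q_def)
  have QD: "Q \<subseteq> D" by (auto simp: Q_def)
  note fa = frac_multiples[OF D_carr[OF ab(1)] a0]
  have "Q \<cdot> multiples a \<subseteq> P"
  proof (rule prod_le[OF fracE(1)[OF P(1)]])
    fix y z assume y: "y \<in> Q" and "z \<in> multiples a"
    then obtain d where d: "d \<in> D" "z = d \<otimes> a" by (auto simp: multiples_def)
    then have "y \<otimes> z = d \<otimes> (a \<otimes> y)" using y ab by (auto simp: Q_def m_ac D_carr)
    then show "y \<otimes> z \<in> P" using y d s(4) by (auto simp: Q_def)
  qed
  then have "c (Q \<cdot> multiples a) \<subseteq> P" using c_mono[OF frac_prod[OF f fa] P(1)] P(3) by simp
  then have 1: "c Q \<cdot> multiples a \<subseteq> P" using c_mult[OF f fa] by blast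
  have "c Q \<subseteq> Q"
  proof
    fix y assume y: "y \<in> c Q"
    then have yD: "y \<in> D" using c_le_D[OF f QD] by blast
    have "y \<otimes> a \<in> P" using 1 y multiples_self[OF D_carr[OF ab(1)]] by (auto intro: ideal_prod.prod)
    then show "y \<in> Q" using yD ab by (simp add: Q_def m_comm D_carr)
  qed
  then have "c Q = Q" using c_extensive[OF f] by blast
  moreover have "\<one> \<notin> Q" using ab by (simp add: Q_def D_carr)
  then have "Q \<noteq> D" by auto
  ultimately have "Q = P" using max[OF f QD _ _ PQ] by blast
  then show ?thesis using ab by (auto simp: Q_def)
qed

end

subsection \<open>Integral elements\<close>

context quotient_field
begin

interpretation d: star_operation K D "\<lambda>M. M" by (rule star_operation_id)
interpretation R: domain subring_D by (rule subring_D_domain)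

text \<open>\<open>eval\<close> is a \<open>D\<close>-linear combination of the powers below
  \<open>length p\<close>, each of which \<open>d\<close> clears after the shift by
  \<open>j\<close>.\<close>

lemma eval_denominator:
  assumes "set p \<subseteq> D" "x \<in> carrier K" "d \<in> D" "\<And>i. i < length p \<Longrightarrow> d \<otimes> x [^] (j + i) \<in> D"
  shows "d \<otimes> (x [^] (j::nat) \<otimes> eval p x) \<in> D"
  using assms(1,4)
proof (induction p)
  case (Cons a p)
  have a: "a \<in> D" and p: "set p \<subseteq> carrier K" using Cons D_carr by auto
  have e: "eval p x \<in> carrier K" using eval_in_carrier[OF p assms(2)] .
  have "d \<otimes> (x [^] j \<otimes> eval (a # p) x)
      = a \<otimes> (d \<otimes> (x [^] j \<otimes> x [^] length p)) \<oplus> d \<otimes> (x [^] j \<otimes> eval p x)"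
    using D_carr[OF a] e assms(2) D_carr[OF assms(3)] by (simp add: r_distr m_ac)
  also have "x [^] j \<otimes> x [^] length p = x [^] (j + length p)"
    using assms(2) by (rule nat_pow_mult)
  finally show ?case using Cons a by simp
qed (use assms D_carr in auto)

text \<open>A monic equation of degree m rewrites all powers of \<open>x\<close> as
  \<open>D\<close>-combinations of those below m, and if \<open>b\<close> is a denominator of
  \<open>x\<close>, then \<open>b [^] m\<close> clears these.\<close>

lemma integral_imp_bounded_powers:
  assumes "x \<in> carrier K" "integral_over K D x"
  obtains d where "d \<in> D" "d \<noteq> \<zero>" "\<And>n::nat. d \<otimes> x [^] n \<in> D"
proof -
  obtain p where p: "p \<in> carrier (univ_poly K D)" "p \<noteq> []" "lead_coeff p = \<one>" "eval p x = \<zero>"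
    using assms(2) unfolding integral_over_def by (elim bexE conjE)
  \<comment> \<open>Coefficient lists start with the leading coefficient, so the degree is the
    length of the tail \<open>q\<close>.\<close>
  then obtain q where pq: "p = \<one> # q" by (cases p) auto
  have q: "set q \<subseteq> D" using polynomial_incl[OF p(1)[folded univ_poly_carrier]] pq by auto
  have qc: "set q \<subseteq> carrier K" using q D_carr by blast
  have e: "eval q x \<in> carrier K" using eval_in_carrier[OF qc assms(1)] .
  define m where "m = length q"
  have "x [^] m \<oplus> eval q x = \<zero>" using p(4) assms(1) by (simp add: pq m_def)
  then have xm: "x [^] m = \<ominus> eval q x"
    by (rule minus_equality[symmetric]) (use e assms(1) in auto)
  obtain b where b: "b \<in> D" "b \<noteq> \<zero>" "b \<otimes> x \<in> D" using common_denominator[OF assms(1)] .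
  have "b [^] m \<otimes> x [^] n \<in> D" for n :: nat
  proof (induction n rule: less_induct)
    case (less n)
    show ?case
    proof (cases "n < m")
      case True
      have bc: "b \<in> carrier K" using D_carr[OF b(1)] .
      have "b [^] m = b [^] (m - n) \<otimes> b [^] n" using True nat_pow_mult[OF bc, of "m - n" n] by simp
      then have "b [^] m \<otimes> x [^] n = b [^] (m - n) \<otimes> (b \<otimes> x) [^] n"
        using bc assms(1) by (simp add: nat_pow_distrib m_assoc)
      then show ?thesis using b D_pow by simp
    next
      case False
      define j where "j = n - m"
      have n: "n = j + m" using False by (simp add: j_def)
      have "b [^] m \<otimes> (x [^] j \<otimes> eval q x) \<in> D"
        using less n by (intro eval_denominator q assms(1) D_pow b(1)) (simp add: m_def)
      moreover have "b [^] m \<otimes> x [^] n = \<ominus> (b [^] m \<otimes> (x [^] j \<otimes> eval q x))"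
        using assms(1) e D_carr[OF b(1)] by (simp add: n nat_pow_mult[symmetric] xm r_minus)
      ultimately show ?thesis by simp
    qed
  qed
  moreover have "b [^] k \<noteq> \<zero>" for k :: nat
    using b D_carr[OF b(1)] by (induction k) (simp_all add: integral_iff)
  ultimately show thesis using that D_pow[OF b(1)] by blast
qed

text \<open>In a noetherian ring the union of a nonempty chain of ideals is a member of the chain,
  so Zorn's lemma applies to every nonempty set of ideals.\<close>

lemma noetherian_maximal:
  assumes "noetherian_domain subring_D" "S \<noteq> {}" "\<And>I. I \<in> S \<Longrightarrow> ideal I subring_D"
  shows "\<exists>M\<in>S. \<forall>I\<in>S. M \<subseteq> I \<longrightarrow> I = M"
proof -
  interpret N: noetherian_domain subring_D by fact
  have "\<Union>C \<in> S" if "C \<noteq> {}" "subset.chain S C" for C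
  proof -
    have "subset.chain {I. ideal I subring_D} C"
      using that(2) assms(3) by (auto simp: pred_on.chain_def)
    then have "\<Union>C \<in> C" by (rule N.ideal_chain_is_trivial[OF that(1)])
    moreover have "C \<subseteq> S" using that(2) by (simp add: pred_on.chain_def)
    ultimately show ?thesis by (rule rev_subsetD)
  qed
  then show ?thesis by (rule subset_Zorn_nonempty[OF assms(2)])
qed

text \<open>The exponents are listed in descending order, so that peeling the head off the list
  removes the leading coefficient, as in the recursion of \<open>eval\<close>.\<close>

lemma Span_powers_eval:
  assumes "x \<in> Span D (map (\<lambda>i. m \<otimes> y [^] i) (rev [0..<n]))" "m \<in> carrier K" "y \<in> carrier K"
  shows "\<exists>p. set p \<subseteq> D \<and> length p = n \<and> x = m \<otimes> eval p y"
  using assms(1)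
proof (induction n arbitrary: x)
  case 0
  then show ?case using assms by auto
next
  case (Suc n)
  then obtain d s where d: "d \<in> D" "s \<in> Span D (map (\<lambda>i. m \<otimes> y [^] i) (rev [0..<n]))"
    "x = d \<otimes> (m \<otimes> y [^] n) \<oplus> s"
    by (auto simp: line_extension_mem_iff)
  obtain p where p: "set p \<subseteq> D" "length p = n" "s = m \<otimes> eval p y" using Suc.IH[OF d(2)] by blast
  have "eval p y \<in> carrier K" using p D_carr assms by (intro eval_in_carrier) auto
  then have "x = m \<otimes> eval (d # p) y"
    using d p assms D_carr[OF d(1)] by (simp add: r_distr m_ac)
  then show ?case using d p by (intro exI[of _ "d # p"]) auto
qed

text \<open>The ideals generated by m, my, ..., my^(n-1) stay in \<open>D\<close> because
  \<open>y\<close> maps \<open>M\<close> into itself. They become stationary, so my^n is a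
  combination of its predecessors; cancelling \<open>m\<close> leaves a monic equation for
  \<open>y\<close>.\<close>

lemma noetherian_stable_imp_integral:
  assumes "noetherian_domain subring_D" "m \<in> M" "m \<noteq> \<zero>" "M \<subseteq> D" "y \<in> carrier K"
    and stable: "\<And>x. x \<in> M \<Longrightarrow> y \<otimes> x \<in> M"
  shows "integral_over K D y"
proof -
  define L where "L n = Span D (map (\<lambda>i. m \<otimes> y [^] i) (rev [0..<n]))" for n :: nat
  have mc: "m \<in> carrier K" using assms D_carr by blast
  have my: "m \<otimes> y [^] (i::nat) \<in> M" for i
  proof (induction i)
    case (Suc i)
    have "m \<otimes> y [^] Suc i = y \<otimes> (m \<otimes> y [^] i)" using mc assms(5) by (simp add: m_ac)
    then show ?case using stable[OF Suc] by simp
  qed (use assms(2) mc in simp)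
  have us: "set (map (\<lambda>i. m \<otimes> y [^] i) (rev [0..<n])) \<subseteq> D" for n
    using my assms(4) by auto
  then have us': "set (map (\<lambda>i. m \<otimes> y [^] i) (rev [0..<n])) \<subseteq> carrier K" for n
    using D_carr by blast
  have sub: "submodule_of K D (L n)" for n unfolding L_def by (intro submodule_Span us')
  have "ideal (L n) subring_D" for n
    unfolding ideal_iff_submodule using sub Span_least[OF submodule_D us] by (simp add: L_def)
  then have "I \<in> range L \<Longrightarrow> ideal I subring_D" for I by auto
  then have "\<exists>N\<in>range L. \<forall>I\<in>range L. N \<subseteq> I \<longrightarrow> I = N"
    by (intro noetherian_maximal[OF assms(1)]) auto
  then obtain n where max: "\<And>k. L n \<subseteq> L k \<Longrightarrow> L k = L n" by auto
  have "L n \<subseteq> L (Suc n)"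
    unfolding L_def using Span_incl[OF us', of "Suc n"]
    by (intro Span_least submodule_Span us') auto
  then have "L (Suc n) = L n" by (rule max)
  then have "m \<otimes> y [^] n \<in> L n" using Span_incl[OF us', of "Suc n"] unfolding L_def by auto
  then have "\<ominus> (m \<otimes> y [^] n) \<in> L n" by (rule submoduleE(5)[OF sub])
  then obtain p where p: "set p \<subseteq> D" "length p = n" "\<ominus> (m \<otimes> y [^] n) = m \<otimes> eval p y"
    using Span_powers_eval mc assms(5) unfolding L_def by blast
  have e: "eval p y \<in> carrier K" using p D_carr assms by (intro eval_in_carrier) auto
  have "m \<otimes> (\<ominus> (y [^] n)) = m \<otimes> eval p y" unfolding p(3)[symmetric] using mc assms(5) by (intro r_minus) auto
  then have "eval p y = \<ominus> (y [^] n)" using m_lcancel[OF assms(3) mc] e assms(5) by simp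
  then have "eval (\<one> # p) y = \<zero>" using p assms(5) by (simp add: r_neg)
  moreover have "polynomial\<^bsub>K\<^esub> D (\<one> # p)" using p by (intro polynomialI) auto
  ultimately show ?thesis
    unfolding integral_over_def by (intro bexI[of _ "\<one> # p"]) (auto simp: univ_poly_carrier[symmetric])
qed

subsection \<open>Principal ideal domains\<close>

lemma proper_ideals_iff: "I \<in> proper_ideals K D \<longleftrightarrow> fractional I \<and> I \<subseteq> D \<and> I \<noteq> D"
  by (auto simp: proper_ideals_def nonzero_integral_iff)

lemma ideal_zero_or_fractional: "ideal I subring_D \<Longrightarrow> I = {\<zero>} \<or> fractional I \<and> I \<subseteq> D"
  unfolding nonzero_integral_iff[symmetric] nonzero_integral_ideal_def by blast

lemma fractional_imp_ideal: "fractional I \<Longrightarrow> I \<subseteq> D \<Longrightarrow> ideal I subring_D"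
  using nonzero_integral_iff nonzero_integral_ideal_def by metis

lemma each_contained_inD: "S \<lhd>\<^sub>P Q \<Longrightarrow> s \<in> S \<Longrightarrow> \<exists>g\<in>S. s \<subseteq> g \<and> Q g"
  by (simp add: each_contained_in_def)

lemma multiples_zero: "multiples \<zero> = {\<zero>}"
proof -
  have "multiples \<zero> = (\<lambda>d. \<zero>) ` D" unfolding multiples_def using D_carr by (intro image_cong) auto
  also have "\<dots> = {\<zero>}" using D_closed(1) by blast
  finally show ?thesis .
qed

lemma PIdl_eq_multiples: "PIdl\<^bsub>subring_D\<^esub> a = multiples a"
  by (auto simp: cgenideal_def multiples_def)

text \<open>In a PID each proper ideal covers itself. Conversely \<open>all_in_group\<close> is
  applied to the identity operation and the group of principal fractional ideals with nonzero
  generator; the zero ideal is treated apart.\<close>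

lemma principal_domain_iff:
  assumes "t_ACC K D"
  shows "principal_domain subring_D \<longleftrightarrow> proper_ideals K D \<lhd>\<^sub>P
    (\<lambda>J. J \<noteq> D \<and> J \<noteq> {\<zero>} \<and> principalideal J subring_D)"
proof
  assume "principal_domain subring_D"
  then interpret P: principal_domain subring_D .
  show "proper_ideals K D \<lhd>\<^sub>P (\<lambda>J. J \<noteq> D \<and> J \<noteq> {\<zero>} \<and> principalideal J subring_D)"
    unfolding each_contained_in_def
  proof
    fix s assume s: "s \<in> proper_ideals K D"
    then have i: "ideal s subring_D" "s \<noteq> {\<zero>}" "s \<noteq> D"
      by (auto simp: proper_ideals_def nonzero_integral_ideal_def)
    then have "principalideal s subring_D"
      using P.exists_gen[OF i(1)] R.cgenideal_eq_genideal by (intro principalidealI) auto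
    then show "\<exists>g\<in>proper_ideals K D. s \<subseteq> g \<and> g \<noteq> D \<and> g \<noteq> {\<zero>} \<and> principalideal g subring_D"
      using s i by blast
  qed
next
  assume cov: "proper_ideals K D \<lhd>\<^sub>P (\<lambda>J. J \<noteq> D \<and> J \<noteq> {\<zero>} \<and> principalideal J subring_D)"
  define H where "H = multiples ` (carrier K - {\<zero>})"
  have all: "I \<in> H" if "fractional I" "I \<subseteq> D" for I
  proof (rule d.all_in_group[OF assms])
    fix A assume "A \<in> H"
    then obtain x where x: "x \<in> carrier K" "x \<noteq> \<zero>" "A = multiples x" by (auto simp: H_def)
    then show "d.star_invertible A \<and> A = A" using d.star_invertible_multiples by simp
    then show "t_ideal K D A \<and> t_invertible K D A" using invertible_imp_t d_invertible_iff by blast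
    show "inv_ideal A \<in> H" unfolding H_def x(3) ideal_inv_multiples[OF x(1,2)]
      using inv_facts[OF x(1,2)] by blast
    fix B assume "B \<in> H"
    then obtain y where y: "y \<in> carrier K" "y \<noteq> \<zero>" "B = multiples y" by (auto simp: H_def)
    show "A \<cdot> B \<in> H" using x y integral_iff by (auto simp: multiples_prod H_def)
  next
    fix x assume "x \<in> carrier K" "x \<noteq> \<zero>"
    then show "multiples x \<in> H" by (auto simp: H_def)
  next
    fix I assume I: "fractional I" "I \<subseteq> D" "I \<noteq> D"
    then have "I \<in> proper_ideals K D" by (simp add: proper_ideals_iff)
    from each_contained_inD[OF cov this]
    obtain J where J: "J \<in> proper_ideals K D" "I \<subseteq> J" "principalideal J subring_D" by blast
    obtain i where i: "i \<in> D" "J = Idl\<^bsub>subring_D\<^esub> {i}" using principalideal.generate[OF J(3)] by auto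
    then have Ji: "J = multiples i" using R.cgenideal_eq_genideal[of i] PIdl_eq_multiples by simp
    have "i \<noteq> \<zero>"
    proof
      assume "i = \<zero>"
      then have "J = {\<zero>}" unfolding Ji by (simp add: multiples_zero)
      moreover have "fractional J" using J(1) by (simp add: proper_ideals_iff)
      ultimately show False using fracE(2)[of J] by simp
    qed
    then have "J \<in> H" using Ji i D_carr by (auto simp: H_def)
    then show "\<exists>J\<in>H. I \<subseteq> J \<and> J \<subseteq> D \<and> J \<noteq> D" using J unfolding proper_ideals_iff by blast
  qed (use that in auto)
  show "principal_domain subring_D"
  proof (intro principal_domain.intro principal_domain_axioms.intro subring_D_domain)
    fix I assume I: "ideal I subring_D"
    show "\<exists>a\<in>carrier subring_D. I = PIdl\<^bsub>subring_D\<^esub> a"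
    proof (cases "I = {\<zero>}")
      case True
      then have "I = multiples \<zero>" by (simp add: multiples_zero)
      then show ?thesis unfolding PIdl_eq_multiples by auto
    next
      case False
      then have f: "fractional I" "I \<subseteq> D" using ideal_zero_or_fractional[OF I] by auto
      then obtain x where x: "x \<in> carrier K" "I = multiples x" using all by (auto simp: H_def)
      then have "x \<in> D" using multiples_self f by blast
      then show ?thesis unfolding PIdl_eq_multiples using x by auto
    qed
  qed
qed

subsection \<open>Dedekind domains\<close>

text \<open>Writing \<open>\<one>\<close> as an element of \<open>I \<cdot> inv_ideal I\<close>
  involves finitely many elements of \<open>I\<close>, and these generate \<open>I\<close>. Integral
  elements have powers with a common denominator, so complete integral closedness applies. For a
  prime \<open>Q\<close> below a larger \<open>J\<close>, cancelling \<open>Q\<close> yields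
  \<open>inv_ideal J \<subseteq> D\<close>, whence \<open>J = D\<close>.\<close>

lemma all_invertible_imp_dedekind:
  assumes inv: "\<And>I. fractional I \<Longrightarrow> I \<subseteq> D \<Longrightarrow> invertible_ideal K D I"
  shows "dedekind_domain K D"
  unfolding dedekind_domain_def
proof (intro conjI ballI allI impI)
  have "noetherian_ring subring_D"
  proof (rule R.noetherian_ringI)
    fix I assume I: "ideal I subring_D"
    show "\<exists>A\<subseteq>carrier subring_D. finite A \<and> I = Idl\<^bsub>subring_D\<^esub> A"
    proof (cases "I = {\<zero>}")
      case True
      then have "I = Idl\<^bsub>subring_D\<^esub> {\<zero>}" using R.genideal_zero by simp
      then show ?thesis by (intro exI[of _ "{\<zero>}"]) auto
    next
      case False
      then have f: "fractional I" and ID: "I \<subseteq> D" using ideal_zero_or_fractional[OF I] by auto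
      then have prod: "I \<cdot> inv_ideal I = D" using inv by (auto simp: invertible_ideal_def)
      have mono: "Idl\<^bsub>subring_D\<^esub> F \<subseteq> Idl\<^bsub>subring_D\<^esub> G" if "F \<subseteq> G" for F G
        using that unfolding genideal_def by blast
      have "x \<in> I \<cdot> inv_ideal I \<Longrightarrow> \<exists>F. finite F \<and> F \<subseteq> I \<and> x \<in> (Idl\<^bsub>subring_D\<^esub> F) \<cdot> inv_ideal I" for x
      proof (induction rule: ideal_prod.induct)
        case (prod i j)
        have "i \<in> Idl\<^bsub>subring_D\<^esub> {i}" using R.genideal_self[of "{i}"] prod ID by auto
        then show ?case using prod by (intro exI[of _ "{i}"]) (auto intro: ideal_prod.prod)
      next
        case (sum x y)
        then obtain F G where F: "finite F" "F \<subseteq> I" "x \<in> (Idl\<^bsub>subring_D\<^esub> F) \<cdot> inv_ideal I"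
          and G: "finite G" "G \<subseteq> I" "y \<in> (Idl\<^bsub>subring_D\<^esub> G) \<cdot> inv_ideal I" by blast
        have "(Idl\<^bsub>subring_D\<^esub> F) \<cdot> inv_ideal I \<subseteq> (Idl\<^bsub>subring_D\<^esub> (F \<union> G)) \<cdot> inv_ideal I"
          "(Idl\<^bsub>subring_D\<^esub> G) \<cdot> inv_ideal I \<subseteq> (Idl\<^bsub>subring_D\<^esub> (F \<union> G)) \<cdot> inv_ideal I"
          by (intro prod_le_prod mono; simp)+
        then have "x \<oplus> y \<in> (Idl\<^bsub>subring_D\<^esub> (F \<union> G)) \<cdot> inv_ideal I"
          using F G by (auto intro: ideal_prod.sum)
        then show ?case using F G by (intro exI[of _ "F \<union> G"]) auto
      qed
      then obtain F where F: "finite F" "F \<subseteq> I" "\<one> \<in> (Idl\<^bsub>subring_D\<^esub> F) \<cdot> inv_ideal I"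
        using prod D_closed(2) by blast
      \<comment> \<open>Adjoining \<open>m\<close> to the generators makes the generated ideal
        visibly nonzero, hence fractional.\<close>
      obtain m where m: "m \<in> I" "m \<noteq> \<zero>" using fracE(2)[OF f] by blast
      define M where "M = Idl\<^bsub>subring_D\<^esub> (insert m F)"
      have sub: "insert m F \<subseteq> D" using m F ID by auto
      have M: "ideal M subring_D" unfolding M_def using R.genideal_ideal sub by simp
      have "m \<in> M" unfolding M_def using R.genideal_self[of "insert m F"] sub by auto
      then have fM: "fractional M" using ideal_zero_or_fractional[OF M] m by auto
      have MI: "M \<subseteq> I" unfolding M_def using R.genideal_minimal[OF I] m F by simp
      have "\<one> \<in> M \<cdot> inv_ideal I"
        using F(3) prod_le_prod[OF mono[of F "insert m F"]] unfolding M_def by blast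
      then have "multiples \<one> \<subseteq> M \<cdot> inv_ideal I"
        by (intro multiples_le fracE(1) frac_prod fM frac_ideal_inv f)
      then have "D \<cdot> I \<subseteq> (M \<cdot> inv_ideal I) \<cdot> I" unfolding multiples_one by (intro prod_le_prod) auto
      also have "\<dots> = M \<cdot> (inv_ideal I \<cdot> I)" by (intro prod_assoc fM frac_ideal_inv f)
      also have "\<dots> = M" using prod prod_comm[OF f frac_ideal_inv[OF f]] D_prod(2)[OF fM] by simp
      finally have "I = M" using MI D_prod(1)[OF f] by simp
      then show ?thesis unfolding M_def using F sub by (intro exI[of _ "insert m F"]) auto
    qed
  qed
  then show "noetherian_domain subring_D"
    using subring_D_domain noetherian_domain.intro by blast
next
  fix x assume x: "x \<in> carrier K" "integral_over K D x"
  obtain e where e: "e \<in> D" "e \<noteq> \<zero>" "\<And>n::nat. e \<otimes> x [^] n \<in> D"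
    using integral_imp_bounded_powers[OF x] by blast
  show "x \<in> D"
    using d.completely_integrally_closed[OF _ e(1,2) x(1) e(3)] inv d_invertible_iff by blast
next
  fix Q assume "primeideal Q subring_D \<and> Q \<noteq> {\<zero>}"
  then have Q: "primeideal Q subring_D" "Q \<noteq> {\<zero>}" by auto
  then interpret Q: primeideal Q subring_D by simp
  have Qi: "ideal Q subring_D" by (rule Q.ideal_axioms)
  have f: "fractional Q" and QD: "Q \<subseteq> D" using ideal_zero_or_fractional[OF Qi] Q(2) by auto
  show "maximalideal Q subring_D"
  proof (rule maximalidealI[OF Qi Q.I_notcarr])
    fix J assume J: "ideal J subring_D" "Q \<subseteq> J" "J \<subseteq> carrier subring_D"
    obtain m where m: "m \<in> Q" "m \<noteq> \<zero>" using fracE(2)[OF f] by blast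
    have fJ: "fractional J" and JD: "J \<subseteq> D"
      using ideal_zero_or_fractional[OF J(1)] m J by auto
    note fJ' = frac_ideal_inv[OF fJ] and fQ' = frac_ideal_inv[OF f]
    show "J = Q \<or> J = carrier subring_D"
    proof (cases "J \<subseteq> Q")
      case False
      then obtain a where a: "a \<in> J" "a \<notin> Q" by blast
      have J1: "J \<cdot> inv_ideal J = D" and Q1: "Q \<cdot> inv_ideal Q = D"
        using inv[OF fJ JD] inv[OF f QD] by (auto simp: invertible_ideal_def)
      \<comment> \<open>An element \<open>a\<close> of \<open>J\<close> outside \<open>Q\<close>
        moves \<open>y \<otimes> q\<close> into \<open>Q\<close>, and primality removes
        \<open>a\<close> again.\<close>
      have "inv_ideal J \<cdot> Q \<subseteq> Q"
      proof (rule prod_le[OF fracE(1)[OF f]])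
        fix y q assume y: "y \<in> inv_ideal J" and q: "q \<in> Q"
        have c: "y \<in> carrier K" "a \<in> D" "q \<in> D" using ideal_invD(2)[OF y] q a JD QD by auto
        have yq: "y \<otimes> q \<in> D" and ya: "y \<otimes> a \<in> D" using ideal_invD(1)[OF y] q J a by auto
        have "a \<otimes> (y \<otimes> q) = (y \<otimes> a) \<otimes> q" using c D_carr by (simp add: m_ac)
        also have "\<dots> \<in> Q" using submoduleE(4)[OF fracE(1)[OF f] ya q] .
        finally show "y \<otimes> q \<in> Q" using Q.I_prime[of a "y \<otimes> q"] a c yq by auto
      qed
      then have "(inv_ideal J \<cdot> Q) \<cdot> inv_ideal Q \<subseteq> Q \<cdot> inv_ideal Q" by (intro prod_le_prod) auto
      then have "inv_ideal J \<subseteq> D"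
        using prod_assoc[OF fJ' f fQ'] Q1 D_prod(2)[OF fJ'] by simp
      then have "J \<cdot> inv_ideal J \<subseteq> J \<cdot> D" by (intro prod_le_prod) auto
      then show ?thesis using J1 D_prod(2)[OF fJ] JD by simp
    qed (use J in auto)
  qed
qed

text \<open>
  For \<open>0 \<noteq> a \<in> M\<close>, a colon ideal \<open>(a D : b)\<close> that is maximal among those inside \<open>M\<close> is prime, hence
  equal to \<open>M\<close>; then \<open>b / a\<close> is the required element.
\<close>

lemma noetherian_prime_maximal_imp_inverse_large:
  assumes noeth: "noetherian_domain subring_D"
    and dim: "\<And>Q. primeideal Q subring_D \<Longrightarrow> Q \<noteq> {\<zero>} \<Longrightarrow> maximalideal Q subring_D"
    and M: "fractional M" "M \<subseteq> D" "M \<noteq> D"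
    and prime: "\<And>a b. a \<in> D \<Longrightarrow> b \<in> D \<Longrightarrow> a \<otimes> b \<in> M \<Longrightarrow> a \<notin> M \<Longrightarrow> b \<in> M"
  obtains y where "y \<in> inv_ideal M" "y \<notin> D"
proof -
  note Ms = fracE(1)[OF M(1)]
  obtain a where a: "a \<in> M" "a \<noteq> \<zero>" using fracE(2)[OF M(1)] by blast
  have aD: "a \<in> D" and ac: "a \<in> carrier K" using a M D_carr by auto
  note as = submoduleE[OF submodule_multiples[OF ac]]
  define C where "C b = {d \<in> D. d \<otimes> b \<in> multiples a}" for b
  have Cid: "ideal (C b) subring_D" if b: "b \<in> D" for b
    unfolding ideal_iff_submodule
  proof
    show "submodule_of K D (C b)"
    proof (rule submoduleI)
      show "C b \<subseteq> carrier K" using D_carr by (auto simp: C_def)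
      show "\<zero> \<in> C b" using as(2) D_carr[OF b] by (simp add: C_def)
      show "x \<oplus> y \<in> C b" if "x \<in> C b" "y \<in> C b" for x y
        using that as(3)[of "x \<otimes> b" "y \<otimes> b"] b by (simp add: C_def l_distr D_carr)
      show "d \<otimes> x \<in> C b" if "d \<in> D" "x \<in> C b" for d x
        using that as(4)[of d "x \<otimes> b"] b by (simp add: C_def m_assoc D_carr)
    qed
  qed (auto simp: C_def)
  have M1: "\<one> \<notin> M"
  proof
    assume "\<one> \<in> M"
    then have "multiples \<one> \<subseteq> M" by (rule multiples_le[OF Ms])
    then show False using M multiples_one by simp
  qed
  define S where "S = {C b |b. b \<in> D \<and> C b \<subseteq> M}"
  \<comment> \<open>\<open>C \<one>\<close> is the principal ideal of \<open>a\<close>, which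
    witnesses that \<open>S\<close> is nonempty.\<close>
  have "C \<one> \<subseteq> M" using multiples_le[OF Ms a(1)] D_carr by (auto simp: C_def)
  then have "S \<noteq> {}" unfolding S_def using D_closed(2) by blast
  moreover have "I \<in> S \<Longrightarrow> ideal I subring_D" for I unfolding S_def using Cid by blast
  ultimately have "\<exists>Q\<in>S. \<forall>I\<in>S. Q \<subseteq> I \<longrightarrow> I = Q"
    by (rule noetherian_maximal[OF noeth])
  then obtain Q where QS: "Q \<in> S" and max: "\<And>I. I \<in> S \<Longrightarrow> Q \<subseteq> I \<Longrightarrow> I = Q" by auto
  then obtain b where b: "b \<in> D" "Q = C b" "C b \<subseteq> M" unfolding S_def by blast
  have aQ: "a \<in> Q" using aD b m_comm[OF ac D_carr[OF b(1)]] by (auto simp: C_def multiples_def)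
  \<comment> \<open>Passing from \<open>b\<close> to \<open>x \<otimes> b\<close> strictly enlarges
    the colon ideal, since \<open>y\<close> is new. By maximality the larger one leaves
    \<open>M\<close>, and \<open>s\<close> is an element outside.\<close>
  have step: "\<exists>s\<in>D. s \<notin> M \<and> s \<otimes> (x \<otimes> b) \<in> multiples a"
    if x: "x \<in> D" "y \<in> D" "y \<notin> C b" "y \<in> C (x \<otimes> b)" "b \<in> D"
      and le: "C b \<subseteq> M" and mx: "\<And>I. I \<in> S \<Longrightarrow> C b \<subseteq> I \<Longrightarrow> I = C b" for x y b
  proof -
    have "C b \<subseteq> C (x \<otimes> b)"
    proof
      fix d assume d: "d \<in> C b"
      have "d \<otimes> (x \<otimes> b) = x \<otimes> (d \<otimes> b)" using d x by (auto simp: C_def m_ac D_carr)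
      then show "d \<in> C (x \<otimes> b)" using d x as(4) by (auto simp: C_def)
    qed
    then have "C (x \<otimes> b) \<notin> S" using mx x by blast
    then have "\<not> C (x \<otimes> b) \<subseteq> M" using x unfolding S_def by auto
    then show ?thesis by (auto simp: C_def)
  qed
  have "primeideal Q subring_D"
  proof (rule primeidealI)
    show "ideal Q subring_D" using Cid b by simp
    show "cring subring_D" by (rule R.cring_axioms)
    show "carrier subring_D \<noteq> Q" using b M1 by auto
    fix x y assume "x \<in> carrier subring_D" "y \<in> carrier subring_D" "x \<otimes>\<^bsub>subring_D\<^esub> y \<in> Q"
    then have xy: "x \<in> D" "y \<in> D" "x \<otimes> y \<in> C b" using b by auto
    show "x \<in> Q \<or> y \<in> Q"
    proof (rule ccontr)
      assume "\<not> ?thesis"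
      then have n: "x \<notin> C b" "y \<notin> C b" using b by auto
      have "y \<otimes> (x \<otimes> b) = (x \<otimes> y) \<otimes> b" using xy b D_carr by (simp add: m_ac)
      then have "y \<in> C (x \<otimes> b)" using xy by (simp add: C_def)
      then obtain s where s: "s \<in> D" "s \<notin> M" "s \<otimes> (x \<otimes> b) \<in> multiples a"
        using step[OF xy(1,2) n(2) _ b(1) b(3)] max b by blast
      \<comment> \<open>The same step is repeated with \<open>s\<close> in place of \<open>x\<close>
        and \<open>x\<close> in place of \<open>y\<close>. It produces \<open>u\<close> outside
        \<open>M\<close> with \<open>u \<otimes> s\<close> in \<open>C b \<subseteq> M\<close>,
        against the primality of \<open>M\<close>.\<close>
      have "x \<otimes> (s \<otimes> b) = s \<otimes> (x \<otimes> b)" using xy s b D_carr by (simp add: m_ac)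
      then have "x \<in> C (s \<otimes> b)" using xy s by (simp add: C_def)
      then obtain u where u: "u \<in> D" "u \<notin> M" "u \<otimes> (s \<otimes> b) \<in> multiples a"
        using step[OF s(1) xy(1) n(1) _ b(1) b(3)] max b by blast
      have "(u \<otimes> s) \<otimes> b = u \<otimes> (s \<otimes> b)" using u s b D_carr by (simp add: m_assoc)
      then have "u \<otimes> s \<in> C b" using u s by (simp add: C_def)
      then have "u \<otimes> s \<in> M" using b(3) by blast
      then show False using prime u s by blast
    qed
  qed
  moreover have "Q \<noteq> {\<zero>}" using aQ a by auto
  ultimately have "maximalideal Q subring_D" by (rule dim)
  then have "M = Q \<or> M = D"
    using maximalideal.I_maximal[OF _ fractional_imp_ideal[OF M(1,2)], of Q] b(2,3) M(2) by simp
  then have MQ: "M = C b" using M(3) b(2) by simp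
  note i = inv_facts[OF ac a(2)]
  define y where "y = b \<otimes> inv a"
  have yc: "y \<in> carrier K" using b i D_carr by (simp add: y_def)
  have "y \<in> inv_ideal M"
  proof -
    have "y \<otimes> q \<in> D" if q: "q \<in> M" for q
    proof -
      obtain e where e: "q \<in> D" "e \<in> D" "q \<otimes> b = e \<otimes> a"
        using q unfolding MQ by (auto simp: C_def multiples_def)
      have "y \<otimes> q = (q \<otimes> b) \<otimes> inv a"
        using D_carr[OF e(1)] D_carr[OF b(1)] i(1) by (simp add: y_def m_ac)
      also have "\<dots> = e" unfolding e(3) using D_carr[OF e(2)] i ac by (simp add: m_assoc)
      finally show ?thesis using e by simp
    qed
    then show ?thesis using yc by (auto simp: ideal_inv_def)
  qed
  \<comment> \<open>If \<open>y\<close> were in \<open>D\<close>, then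
    \<open>b = y \<otimes> a\<close> would be a multiple of \<open>a\<close>, and
    \<open>C b = M\<close> would contain \<open>\<one>\<close>.\<close>
  moreover have "y \<notin> D"
  proof
    assume y: "y \<in> D"
    have "y \<otimes> a = b" using D_carr[OF b(1)] i ac by (simp add: y_def m_assoc)
    then have "b \<in> multiples a" using y by (auto simp: multiples_def)
    then have "\<one> \<in> C b" using D_carr[OF b(1)] by (simp add: C_def)
    then show False using M1 MQ by simp
  qed
  ultimately show thesis using that by blast
qed

text \<open>For the covering, take \<open>M\<close> maximal among the proper ideals above
  \<open>s\<close> and \<open>y\<close> in its inverse but not in \<open>D\<close>. If
  \<open>M\<close> were not invertible, its product with the inverse would be \<open>M\<close> again
  by maximality. Then \<open>y\<close> maps \<open>M\<close> into itself, is integral, and lies in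
  \<open>D\<close>. The converse uses \<open>all_in_group\<close> with the identity and all
  invertible ideals.\<close>

lemma dedekind_domain_iff:
  assumes "t_ACC K D"
  shows "dedekind_domain K D \<longleftrightarrow> proper_ideals K D \<lhd>\<^sub>P (\<lambda>J. J \<noteq> D \<and> invertible_ideal K D J)"
proof
  assume ded: "dedekind_domain K D"
  then have noeth: "noetherian_domain subring_D"
    and closed: "\<And>x. x \<in> carrier K \<Longrightarrow> integral_over K D x \<Longrightarrow> x \<in> D"
    and dim: "\<And>Q. primeideal Q subring_D \<Longrightarrow> Q \<noteq> {\<zero>} \<Longrightarrow> maximalideal Q subring_D"
    by (auto simp: dedekind_domain_def)
  show "proper_ideals K D \<lhd>\<^sub>P (\<lambda>J. J \<noteq> D \<and> invertible_ideal K D J)"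
    unfolding each_contained_in_def
  proof
    fix s assume s: "s \<in> proper_ideals K D"
    define S where "S = {I \<in> proper_ideals K D. s \<subseteq> I}"
    have "S \<noteq> {}" using s by (auto simp: S_def)
    moreover have "ideal I subring_D" if "I \<in> S" for I
      using that fractional_imp_ideal unfolding S_def proper_ideals_iff by blast
    ultimately have "\<exists>M\<in>S. \<forall>I\<in>S. M \<subseteq> I \<longrightarrow> I = M"
      by (rule noetherian_maximal[OF noeth])
    then obtain M where MS: "M \<in> S" and max: "\<And>I. I \<in> S \<Longrightarrow> M \<subseteq> I \<Longrightarrow> I = M" by auto
    have M: "fractional M" "M \<subseteq> D" "M \<noteq> D" and sM: "s \<subseteq> M"
      using MS unfolding S_def proper_ideals_iff by auto
    have max': "I = M" if "fractional I" "I \<subseteq> D" "I \<noteq> D" "M \<subseteq> I" for I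
      using max[of I] that sM unfolding S_def proper_ideals_iff by blast
    note i = frac_ideal_inv[OF M(1)]
    obtain y where y: "y \<in> inv_ideal M" "y \<notin> D"
      using noetherian_prime_maximal_imp_inverse_large[OF noeth dim M]
        d.maximal_star_ideal_prime[OF M(1,2) refl M(3)] max' by blast
    have yc: "y \<in> carrier K" using y ideal_invD by blast
    have "M \<cdot> inv_ideal M = D"
    proof (rule ccontr)
      assume ne: "M \<cdot> inv_ideal M \<noteq> D"
      have "x \<in> M \<cdot> inv_ideal M" if "x \<in> M" for x
        using ideal_prod.prod[OF that one_in_ideal_inv[OF M(1,2)], of K] fracE(4)[OF M(1) that] by simp
      then have eq: "M \<cdot> inv_ideal M = M"
        using ne by (intro max' frac_prod M i prod_inv_le) auto
      have "y \<otimes> x \<in> M" if "x \<in> M" for x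
        using ideal_prod.prod[OF that y(1), of K] eq m_comm[OF yc fracE(4)[OF M(1) that]] by simp
      moreover obtain m where "m \<in> M" "m \<noteq> \<zero>" using fracE(2)[OF M(1)] by blast
      ultimately have "integral_over K D y"
        using noetherian_stable_imp_integral[OF noeth _ _ M(2) yc] by blast
      then show False using closed yc y by blast
    qed
    then have "invertible_ideal K D M" using M by (simp add: invertible_ideal_def)
    then show "\<exists>g\<in>proper_ideals K D. s \<subseteq> g \<and> g \<noteq> D \<and> invertible_ideal K D g"
      using MS sM M unfolding S_def by blast
  qed
next
  assume cov: "proper_ideals K D \<lhd>\<^sub>P (\<lambda>J. J \<noteq> D \<and> invertible_ideal K D J)"
  have "I \<in> Collect d.star_invertible" if "fractional I" "I \<subseteq> D" for I
  proof (rule d.all_in_group[OF assms])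
    fix I assume "fractional I" "I \<subseteq> D" "I \<noteq> D"
    then have "I \<in> proper_ideals K D" by (simp add: proper_ideals_iff)
    from each_contained_inD[OF cov this]
    obtain J where "J \<in> proper_ideals K D" "I \<subseteq> J" "invertible_ideal K D J" by blast
    then show "\<exists>J\<in>Collect d.star_invertible. I \<subseteq> J \<and> J \<subseteq> D \<and> J \<noteq> D"
      by (intro bexI[of _ J]) (auto simp: d_invertible_iff proper_ideals_iff)
  qed (use that invertible_imp_t d_invertible_iff d.star_invertible_prod d.star_invertible_inv
      d.star_invertible_multiples in auto)
  then show "dedekind_domain K D"
    using all_invertible_imp_dedekind d_invertible_iff by blast
qed

end

subsection \<open>Krull domains\<close>

text \<open>The localization of \<open>D\<close> at \<open>P\<close> is a discrete valuation ring with uniformizer \<open>p\<close>.\<close>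

locale uniformized_prime = quotient_field K D for K (structure) and D +
  fixes P p
  assumes P_sub: "submodule_of K D P" and P_D: "P \<subseteq> D" and one_notin_P: "\<one> \<notin> P"
    and P_prime: "a \<in> D \<Longrightarrow> b \<in> D \<Longrightarrow> a \<otimes> b \<in> P \<Longrightarrow> a \<notin> P \<Longrightarrow> b \<in> P"
    and p_P: "p \<in> P" and p_nonzero: "p \<noteq> \<zero>"
    and p_decomp: "x \<in> D \<Longrightarrow> x \<noteq> \<zero> \<Longrightarrow> \<exists>(n::nat). \<exists>a \<in> D - P. \<exists>b \<in> D - P. x \<otimes> b = p [^] n \<otimes> a"
begin

text \<open>\<open>represents x n\<close> says \<open>x = p\<^sup>n a / b\<close> with \<open>a, b \<notin> P\<close>, cleared of negative powers of \<open>p\<close>.\<close>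

definition represents :: "'a \<Rightarrow> int \<Rightarrow> bool"
  where "represents x n \<longleftrightarrow> (\<exists>i j. \<exists>a \<in> D - P. \<exists>b \<in> D - P.
    n = int i - int j \<and> x \<otimes> (p [^] j \<otimes> b) = p [^] i \<otimes> a)"

text \<open>No integer represents zero, so the value there is unspecified, which
  \<open>discrete_valuation\<close> permits.\<close>

definition val :: "'a \<Rightarrow> int"
  where "val x = (THE n. represents x n)"

lemma p_D: "p \<in> D" and p_carr: "p \<in> carrier K"
  using p_P P_D D_carr by auto

lemma compl_mult: "a \<in> D - P \<Longrightarrow> b \<in> D - P \<Longrightarrow> a \<otimes> b \<in> D - P"
  using P_prime by auto

lemma compl_carr: "a \<in> D - P \<Longrightarrow> a \<in> carrier K"
  using D_carr by auto

lemma compl_nonzero: "a \<in> D - P \<Longrightarrow> a \<noteq> \<zero>"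
  using submoduleE(2)[OF P_sub] by auto

lemma p_pow_in_P: "(n::nat) > 0 \<Longrightarrow> w \<in> D \<Longrightarrow> p [^] n \<otimes> w \<in> P"
proof (cases n)
  case (Suc m)
  assume w: "w \<in> D"
  have "p [^] n \<otimes> w = (p [^] m \<otimes> w) \<otimes> p" using Suc w p_carr D_carr by (simp add: m_ac)
  then show ?thesis using submoduleE(4)[OF P_sub _ p_P, of "p [^] m \<otimes> w"] w D_pow[OF p_D] by simp
qed simp

lemma p_pow_nonzero: "p [^] (n::nat) \<noteq> \<zero>"
  using p_nonzero p_carr by (induction n) (simp_all add: integral_iff)

lemma p_pow_carr: "p [^] (n::nat) \<in> carrier K"
  using p_carr by simp

text \<open>After cancelling \<open>p [^] m\<close>, a surplus power of \<open>p\<close> on the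
  right would put \<open>u\<close> into \<open>P\<close>.\<close>

lemma p_pow_eq_imp_le:
  assumes "u \<in> D - P" "w \<in> D" "p [^] (m::nat) \<otimes> u = p [^] (n::nat) \<otimes> w"
  shows "n \<le> m"
proof (rule ccontr)
  assume "\<not> n \<le> m"
  then have "p [^] n = p [^] m \<otimes> p [^] (n - m)" "n - m > 0"
    using nat_pow_mult[OF p_carr, of m "n - m"] by auto
  then have "p [^] m \<otimes> u = p [^] m \<otimes> (p [^] (n - m) \<otimes> w)"
    using assms p_carr D_carr by (simp add: m_assoc)
  then have "u = p [^] (n - m) \<otimes> w"
    using m_lcancel[OF p_pow_nonzero[of m] p_pow_carr[of m], of u "p [^] (n - m) \<otimes> w"]
      assms(1,2) p_carr D_carr by simp
  then show False using p_pow_in_P[OF \<open>n - m > 0\<close> assms(2)] assms(1) by simp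
qed

text \<open>Cross-multiplication of two representations leaves powers of \<open>p\<close> times
  elements outside \<open>P\<close>, and these can be compared in both directions.\<close>

lemma represents_unique:
  assumes "x \<in> carrier K" "represents x n" "represents x m"
  shows "n = m"
proof -
  obtain i j a b where 1: "a \<in> D - P" "b \<in> D - P" "n = int i - int j"
    "x \<otimes> (p [^] j \<otimes> b) = p [^] i \<otimes> a" using assms(2) unfolding represents_def by blast
  obtain k l c d where 2: "c \<in> D - P" "d \<in> D - P" "m = int k - int l"
    "x \<otimes> (p [^] l \<otimes> d) = p [^] k \<otimes> c" using assms(3) unfolding represents_def by blast
  note c = p_pow_carr compl_carr[OF 1(1)] compl_carr[OF 1(2)] compl_carr[OF 2(1)] compl_carr[OF 2(2)]
  have "p [^] (i + l) \<otimes> (a \<otimes> d) = (p [^] i \<otimes> a) \<otimes> (p [^] l \<otimes> d)"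
    using c nat_pow_mult[OF p_carr, of i l, symmetric] by (simp add: m_ac)
  also have "\<dots> = (x \<otimes> (p [^] l \<otimes> d)) \<otimes> (p [^] j \<otimes> b)"
    unfolding 1(4)[symmetric] using c assms(1) by (simp add: m_ac)
  also have "\<dots> = p [^] (k + j) \<otimes> (c \<otimes> b)"
    unfolding 2(4) using c nat_pow_mult[OF p_carr, of k j, symmetric] by (simp add: m_ac)
  finally have e: "p [^] (i + l) \<otimes> (a \<otimes> d) = p [^] (k + j) \<otimes> (c \<otimes> b)" .
  have "k + j \<le> i + l" "i + l \<le> k + j"
    using p_pow_eq_imp_le[OF compl_mult[OF 1(1) 2(2)] _ e]
      p_pow_eq_imp_le[OF compl_mult[OF 2(1) 1(2)] _ e[symmetric]] 1 2 by auto
  then show ?thesis using 1(3) 2(3) by simp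
qed

lemma val_eq: "x \<in> carrier K \<Longrightarrow> represents x n \<Longrightarrow> val x = n"
  unfolding val_def using represents_unique by (intro the_equality) auto

lemma represents_of_fraction:
  assumes "c \<in> D" "d \<in> D" "c \<noteq> \<zero>" "d \<noteq> \<zero>" "d \<otimes> x = c" "x \<in> carrier K"
  shows "\<exists>n. represents x n"
proof -
  obtain n :: nat and a b where 1: "a \<in> D - P" "b \<in> D - P" "c \<otimes> b = p [^] n \<otimes> a"
    using p_decomp[OF assms(1,3)] by blast
  obtain m :: nat and a' b' where 2: "a' \<in> D - P" "b' \<in> D - P" "d \<otimes> b' = p [^] m \<otimes> a'"
    using p_decomp[OF assms(2,4)] by blast
  note c = p_pow_carr compl_carr[OF 1(1)] compl_carr[OF 1(2)] compl_carr[OF 2(1)] compl_carr[OF 2(2)]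
    D_carr[OF assms(1)] D_carr[OF assms(2)] assms(6)
  have "x \<otimes> (p [^] m \<otimes> (a' \<otimes> b)) = x \<otimes> ((p [^] m \<otimes> a') \<otimes> b)" using c by (simp add: m_ac)
  also have "\<dots> = ((d \<otimes> x) \<otimes> b) \<otimes> b'" unfolding 2(3)[symmetric] using c by (simp add: m_ac)
  also have "\<dots> = p [^] n \<otimes> (a \<otimes> b')" unfolding assms(5) 1(3) using c by (simp add: m_ac)
  finally have "represents x (int n - int m)"
    unfolding represents_def using compl_mult[OF 1(1) 2(2)] compl_mult[OF 2(1) 1(2)] by blast
  then show ?thesis ..
qed

lemma represents_exists:
  assumes "x \<in> carrier K" "x \<noteq> \<zero>"
  shows "\<exists>n. represents x n"
proof -
  obtain d where d: "d \<in> D" "d \<noteq> \<zero>" "d \<otimes> x \<in> D" using common_denominator[OF assms(1)] .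
  then have "d \<otimes> x \<noteq> \<zero>" using assms D_carr by (simp add: integral_iff)
  then show ?thesis using represents_of_fraction[OF d(3,1) _ d(2) refl assms(1)] by blast
qed

lemma represents_mult:
  assumes "x \<in> carrier K" "y \<in> carrier K" "represents x n" "represents y m"
  shows "represents (x \<otimes> y) (n + m)"
proof -
  obtain i j a b where 1: "a \<in> D - P" "b \<in> D - P" "n = int i - int j"
    "x \<otimes> (p [^] j \<otimes> b) = p [^] i \<otimes> a" using assms(3) unfolding represents_def by blast
  obtain k l c d where 2: "c \<in> D - P" "d \<in> D - P" "m = int k - int l"
    "y \<otimes> (p [^] l \<otimes> d) = p [^] k \<otimes> c" using assms(4) unfolding represents_def by blast
  note c = p_pow_carr compl_carr[OF 1(1)] compl_carr[OF 1(2)] compl_carr[OF 2(1)] compl_carr[OF 2(2)]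
    assms(1,2)
  have "(x \<otimes> y) \<otimes> (p [^] (j + l) \<otimes> (b \<otimes> d)) = (x \<otimes> (p [^] j \<otimes> b)) \<otimes> (y \<otimes> (p [^] l \<otimes> d))"
    using c nat_pow_mult[OF p_carr, of j l, symmetric] by (simp add: m_ac)
  also have "\<dots> = p [^] (i + k) \<otimes> (a \<otimes> c)"
    unfolding 1(4) 2(4) using c nat_pow_mult[OF p_carr, of i k, symmetric] by (simp add: m_ac)
  moreover have "n + m = int (i + k) - int (j + l)" using 1 2 by simp
  ultimately show ?thesis
    unfolding represents_def using compl_mult[OF 1(1) 2(1)] compl_mult[OF 1(2) 2(2)] by metis
qed

text \<open>Over the common denominator the smaller power of \<open>p\<close> is factored out of the
  numerator. The cofactor \<open>z\<close> is a nonzero element of \<open>D\<close>, and its own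
  decomposition contributes an exponent \<open>s \<ge> 0\<close>.\<close>

lemma represents_add:
  assumes "x \<in> carrier K" "y \<in> carrier K" "represents x n" "represents y m" "x \<oplus> y \<noteq> \<zero>"
  shows "\<exists>k \<ge> min n m. represents (x \<oplus> y) k"
proof -
  obtain i j a b where 1: "a \<in> D - P" "b \<in> D - P" "n = int i - int j"
    "x \<otimes> (p [^] j \<otimes> b) = p [^] i \<otimes> a" using assms(3) unfolding represents_def by blast
  obtain k l c d where 2: "c \<in> D - P" "d \<in> D - P" "m = int k - int l"
    "y \<otimes> (p [^] l \<otimes> d) = p [^] k \<otimes> c" using assms(4) unfolding represents_def by blast
  note c = p_pow_carr compl_carr[OF 1(1)] compl_carr[OF 1(2)] compl_carr[OF 2(1)] compl_carr[OF 2(2)]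
    assms(1,2)
  \<comment> \<open>The numerators over the common denominator have exponents \<open>i + l\<close>
    and \<open>k + j\<close>; subtracting \<open>j + l\<close> from their minimum gives
    \<open>min n m\<close>.\<close>
  define e where "e = min (i + l) (k + j)"
  define z where "z = p [^] (i + l - e) \<otimes> (a \<otimes> d) \<oplus> p [^] (k + j - e) \<otimes> (c \<otimes> b)"
  have zD: "z \<in> D" using 1 2 D_pow[OF p_D] by (simp add: z_def)
  have pow: "p [^] e \<otimes> p [^] (i + l - e) = p [^] (i + l)" "p [^] e \<otimes> p [^] (k + j - e) = p [^] (k + j)"
    using nat_pow_mult[OF p_carr] by (simp_all add: e_def)
  have "(x \<oplus> y) \<otimes> (p [^] (j + l) \<otimes> (b \<otimes> d))
      = (x \<otimes> (p [^] j \<otimes> b)) \<otimes> (p [^] l \<otimes> d) \<oplus> (y \<otimes> (p [^] l \<otimes> d)) \<otimes> (p [^] j \<otimes> b)"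
    using c nat_pow_mult[OF p_carr, of j l, symmetric] by (simp add: m_ac l_distr r_distr)
  also have "\<dots> = p [^] (i + l) \<otimes> (a \<otimes> d) \<oplus> p [^] (k + j) \<otimes> (c \<otimes> b)"
    unfolding 1(4) 2(4)
    using c nat_pow_mult[OF p_carr, of i l, symmetric] nat_pow_mult[OF p_carr, of k j, symmetric]
    by (simp add: m_ac)
  also have "\<dots> = p [^] e \<otimes> z"
    unfolding z_def pow[symmetric] using c by (simp add: r_distr m_assoc)
  finally have xyz: "(x \<oplus> y) \<otimes> (p [^] (j + l) \<otimes> (b \<otimes> d)) = p [^] e \<otimes> z" .
  have "z \<noteq> \<zero>"
  proof
    assume "z = \<zero>"
    then have "(x \<oplus> y) \<otimes> (p [^] (j + l) \<otimes> (b \<otimes> d)) = \<zero>" using xyz p_pow_carr by simp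
    then show False
      using assms(5) c p_pow_nonzero compl_nonzero[OF 1(2)] compl_nonzero[OF 2(2)]
      by (simp add: integral_iff)
  qed
  then obtain s :: nat and g f where 3: "g \<in> D - P" "f \<in> D - P" "z \<otimes> f = p [^] s \<otimes> g"
    using p_decomp[OF zD] by blast
  note c' = c compl_carr[OF 3(1)] compl_carr[OF 3(2)] D_carr[OF zD]
  have "(x \<oplus> y) \<otimes> (p [^] (j + l) \<otimes> ((b \<otimes> d) \<otimes> f)) = ((x \<oplus> y) \<otimes> (p [^] (j + l) \<otimes> (b \<otimes> d))) \<otimes> f"
    using c' by (simp add: m_assoc)
  also have "\<dots> = p [^] e \<otimes> (z \<otimes> f)" unfolding xyz using c' by (simp add: m_assoc)
  also have "\<dots> = p [^] (e + s) \<otimes> g"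
    unfolding 3(3) using c' nat_pow_mult[OF p_carr, of e s, symmetric] by (simp add: m_assoc)
  finally have "represents (x \<oplus> y) (int (e + s) - int (j + l))"
    unfolding represents_def using compl_mult[OF compl_mult[OF 1(2) 2(2)] 3(2)] 3(1) by blast
  moreover have "min n m \<le> int (e + s) - int (j + l)" using 1(3) 2(3) by (simp add: e_def)
  ultimately show ?thesis by blast
qed

lemma represents_pow: "represents (p [^] (n::nat)) (int n)"
  unfolding represents_def
  by (rule exI[of _ n], rule exI[of _ 0], intro bexI[of _ \<one>]) (use one_notin_P p_carr in auto)

lemma represents_inv_pow: "represents (inv (p [^] (n::nat))) (- int n)"
proof -
  have "inv (p [^] n) \<otimes> p [^] n = \<one>" using inv_facts(3)[OF p_pow_carr p_pow_nonzero] .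
  then show ?thesis unfolding represents_def
    by (intro exI[of _ 0] exI[of _ n] bexI[of _ \<one>]) (use one_notin_P p_carr in auto)
qed

lemma discrete_valuation_val: "discrete_valuation K val"
  unfolding discrete_valuation_def
proof (intro conjI ballI impI)
  fix x y assume xy: "x \<in> carrier K - {\<zero>}" "y \<in> carrier K - {\<zero>}"
  then obtain n m where nm: "represents x n" "represents y m" using represents_exists by blast
  then have v: "val x = n" "val y = m" using val_eq xy by auto
  show "val (x \<otimes> y) = val x + val y"
    unfolding v using xy nm by (intro val_eq represents_mult) auto
  assume "x \<oplus> y \<noteq> \<zero>"
  then obtain k where "k \<ge> min n m" "represents (x \<oplus> y) k" using represents_add xy nm by blast
  then show "min (val x) (val y) \<le> val (x \<oplus> y)" using v val_eq[of "x \<oplus> y" k] xy by simp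
next
  show "val ` (carrier K - {\<zero>}) = UNIV"
  proof -
    have "n \<in> val ` (carrier K - {\<zero>})" for n :: int
    proof (cases "n \<ge> 0")
      case True
      then have "val (p [^] nat n) = n"
        by (intro trans[OF val_eq[OF p_pow_carr represents_pow]]) simp
      then show ?thesis using p_pow_carr p_pow_nonzero by (intro image_eqI[of _ val, OF sym]) auto
    next
      case False
      note i = inv_facts[OF p_pow_carr p_pow_nonzero, of "nat (- n)"]
      have "val (inv (p [^] nat (- n))) = n"
        using False by (intro trans[OF val_eq[OF i(1) represents_inv_pow]]) simp
      then show ?thesis using i by (intro image_eqI[of _ val, OF sym]) auto
    qed
    then show ?thesis by blast
  qed
qed

lemma val_nonneg:
  assumes "x \<in> D" "x \<noteq> \<zero>"
  shows "val x \<ge> 0"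
proof -
  obtain n :: nat and a b where "a \<in> D - P" "b \<in> D - P" "x \<otimes> b = p [^] n \<otimes> a"
    using p_decomp[OF assms] by blast
  then have "represents x (int n)"
    unfolding represents_def by (intro exI[of _ n] exI[of _ 0] bexI[of _ a] bexI[of _ b]) (auto simp: D_carr)
  then show ?thesis using val_eq D_carr assms by auto
qed

lemma val_eq_0: "x \<in> D - P \<Longrightarrow> d \<in> D - P \<Longrightarrow> y \<in> carrier K \<Longrightarrow> d \<otimes> y = x \<Longrightarrow> val y = 0"
proof (rule val_eq)
  assume "x \<in> D - P" "d \<in> D - P" "y \<in> carrier K" "d \<otimes> y = x"
  then show "represents y 0"
    unfolding represents_def
    by (intro exI[of _ 0] bexI[of _ x] bexI[of _ d]) (auto simp: m_comm D_carr)
qed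

text \<open>Elements of nonnegative value belong to the localization at \<open>P\<close>: the
  negative powers of \<open>p\<close> cancel, and only a denominator outside \<open>P\<close>
  remains.\<close>

lemma val_nonneg_imp:
  assumes "x \<in> carrier K" "x \<noteq> \<zero>" "val x \<ge> 0"
  obtains b where "b \<in> D - P" "b \<otimes> x \<in> D"
proof -
  obtain n where "represents x n" using represents_exists assms by blast
  then have "represents x (val x)" using val_eq assms by simp
  then obtain i j a b where 1: "a \<in> D - P" "b \<in> D - P" "val x = int i - int j"
    "x \<otimes> (p [^] j \<otimes> b) = p [^] i \<otimes> a" unfolding represents_def by blast
  have ji: "j \<le> i" using 1(3) assms(3) by simp
  note c = p_pow_carr compl_carr[OF 1(1)] compl_carr[OF 1(2)] assms(1)
  have "p [^] j \<otimes> (b \<otimes> x) = x \<otimes> (p [^] j \<otimes> b)" using c by (simp add: m_ac)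
  also have "\<dots> = p [^] j \<otimes> (p [^] (i - j) \<otimes> a)"
    unfolding 1(4) using c nat_pow_mult[OF p_carr, of j "i - j"] ji by (simp add: m_assoc[symmetric])
  finally have "b \<otimes> x = p [^] (i - j) \<otimes> a"
    using m_lcancel[OF p_pow_nonzero p_pow_carr] c by simp
  then show thesis using that[OF 1(2)] 1(1) D_pow[OF p_D] by simp
qed

end

section \<open>Maximal t-ideals and their valuations\<close>

context quotient_field
begin

interpretation t: star_operation K D t_cl by (rule star_operation_t)

definition max_t_ideals :: "'a set set"
  where "max_t_ideals = {P. fractional P \<and> P \<subseteq> D \<and> t_cl P = P \<and> P \<noteq> D \<and>
    (\<forall>I. fractional I \<longrightarrow> I \<subseteq> D \<longrightarrow> t_cl I = I \<longrightarrow> I \<noteq> D \<longrightarrow> P \<subseteq> I \<longrightarrow> I = P)}"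

lemma max_t_idealsD:
  assumes "P \<in> max_t_ideals"
  shows "fractional P" "P \<subseteq> D" "t_cl P = P" "P \<noteq> D" "\<one> \<notin> P"
    "a \<in> D \<Longrightarrow> b \<in> D \<Longrightarrow> a \<otimes> b \<in> P \<Longrightarrow> a \<notin> P \<Longrightarrow> b \<in> P"
    "Q \<in> max_t_ideals \<Longrightarrow> P \<subseteq> Q \<Longrightarrow> Q = P"
proof -
  show P: "fractional P" "P \<subseteq> D" "t_cl P = P" "P \<noteq> D" using assms by (auto simp: max_t_ideals_def)
  show "a \<in> D \<Longrightarrow> b \<in> D \<Longrightarrow> a \<otimes> b \<in> P \<Longrightarrow> a \<notin> P \<Longrightarrow> b \<in> P"
    by (rule t.maximal_star_ideal_prime[OF P]) (use assms in \<open>auto simp: max_t_ideals_def\<close>)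
  show "Q \<in> max_t_ideals \<Longrightarrow> P \<subseteq> Q \<Longrightarrow> Q = P" using assms by (auto simp: max_t_ideals_def)
  show "\<one> \<notin> P"
  proof
    assume "\<one> \<in> P"
    then have "multiples \<one> \<subseteq> P" by (rule multiples_le[OF fracE(1)[OF P(1)]])
    then show False using P multiples_one by simp
  qed
qed

text \<open>
  Since \<open>P P\<^sup>-\<^sup>1\<close> is not contained in \<open>P\<close>, there are \<open>p \<in> P\<close> and \<open>q \<in> P\<^sup>-\<^sup>1\<close> with \<open>p q \<notin> P\<close>. Then
  \<open>x = p\<^sup>n (x q\<^sup>n) / (p q)\<^sup>n\<close>, and \<open>x q\<^sup>n\<close> leaves \<open>P\<close> for some \<open>n\<close> because \<open>q \<notin> D\<close> and \<open>D\<close> is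
  completely integrally closed.
\<close>

lemma uniformized_prime_exists:
  assumes inv: "\<And>I. fractional I \<Longrightarrow> I \<subseteq> D \<Longrightarrow> t.star_invertible I" and P: "P \<in> max_t_ideals"
  shows "\<exists>p. uniformized_prime K D P p"
proof -
  note m = max_t_idealsD[OF P]
  note i = frac_ideal_inv[OF m(1)]
  \<comment> \<open>Otherwise the t-closure of this product would stay in the t-ideal
    \<open>P\<close>, whereas t-invertibility makes it \<open>D\<close>.\<close>
  have "\<not> P \<cdot> inv_ideal P \<subseteq> P"
  proof
    assume "P \<cdot> inv_ideal P \<subseteq> P"
    then have "t_cl (P \<cdot> inv_ideal P) \<subseteq> P" using t_mono[OF frac_prod[OF m(1) i] m(1)] m(3) by simp
    then show False using inv[OF m(1,2)] m(2,4) by (simp add: t.star_invertible_def)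
  qed
  then obtain p q where pq: "p \<in> P" "q \<in> inv_ideal P" "p \<otimes> q \<notin> P"
    using prod_le[OF fracE(1)[OF m(1)]] by blast
  have qc: "q \<in> carrier K" using pq(2) ideal_invD by blast
  have pc: "p \<in> carrier K" using pq(1) m(2) D_carr by blast
  have qp: "q \<otimes> y \<in> D" if "y \<in> P" for y using ideal_invD(1)[OF pq(2) that] .
  have pqD: "p \<otimes> q \<in> D" using qp[OF pq(1)] m_comm[OF pc qc] by simp
  have qD: "q \<notin> D"
  proof
    assume "q \<in> D"
    then have "q \<otimes> p \<in> P" using submoduleE(4)[OF fracE(1)[OF m(1)]] pq by blast
    then show False using pq(3) m_comm[OF pc qc] by simp
  qed
  have "uniformized_prime K D P p"
  proof (intro uniformized_prime.intro quotient_field_axioms uniformized_prime_axioms.intro)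
    show "submodule_of K D P" by (rule fracE(1)[OF m(1)])
    show "p \<noteq> \<zero>" using pq(3) qc submoduleE(2)[OF fracE(1)[OF m(1)]] by auto
    fix x assume x: "x \<in> D" "x \<noteq> \<zero>"
    have xc: "x \<in> carrier K" using x D_carr by blast
    have "\<exists>n::nat. x \<otimes> q [^] n \<in> D - P"
    proof (rule ccontr)
      assume n: "\<not> ?thesis"
      \<comment> \<open>As long as \<open>x \<otimes> q [^] n\<close> remains in \<open>P\<close>,
        multiplication by \<open>q\<close> keeps it in \<open>D\<close>. So \<open>x\<close> would
        be a common denominator for all powers of \<open>q\<close>.\<close>
      have xq: "x \<otimes> q [^] n \<in> D" for n :: nat
      proof (induction n)
        case (Suc n)
        then have "x \<otimes> q [^] n \<in> P" using n by blast
        then have "q \<otimes> (x \<otimes> q [^] n) \<in> D" by (rule qp)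
        moreover have "q \<otimes> (x \<otimes> q [^] n) = x \<otimes> q [^] Suc n" using xc qc by (simp add: m_ac)
        ultimately show ?case by simp
      qed (use x xc in simp)
      have "q \<in> D" by (rule t.completely_integrally_closed[OF inv x qc xq])
      then show False using qD by simp
    qed
    then obtain n :: nat where n: "x \<otimes> q [^] n \<in> D - P" by blast
    have pow: "(p \<otimes> q) [^] k \<in> D - P" for k :: nat
    proof (induction k)
      case (Suc k)
      then show ?case using m(6)[of "(p \<otimes> q) [^] k" "p \<otimes> q"] pq(3) pqD by auto
    qed (use m(5) in simp)
    have "x \<otimes> (p \<otimes> q) [^] n = p [^] n \<otimes> (x \<otimes> q [^] n)"
      using xc pc qc by (simp add: nat_pow_distrib m_ac)
    then show "\<exists>n::nat. \<exists>a\<in>D - P. \<exists>b\<in>D - P. x \<otimes> b = p [^] n \<otimes> a" using n pow by blast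
  next
    fix a b assume "a \<in> D" "b \<in> D" "a \<otimes> b \<in> P" "a \<notin> P"
    then show "b \<in> P" by (rule m(6))
  qed (rule m(2) m(5) pq(1))+
  then show ?thesis ..
qed

text \<open>Once all integral ideals are t-invertible, \<open>t_ACC\<close> is a maximum condition
  on all integral t-ideals.\<close>

lemma max_t_ideal_exists:
  assumes acc: "t_ACC K D" and inv: "\<And>I. fractional I \<Longrightarrow> I \<subseteq> D \<Longrightarrow> t_invertible K D I"
    and I: "fractional I" "I \<subseteq> D" "t_cl I = I" "I \<noteq> D"
  shows "\<exists>P \<in> max_t_ideals. I \<subseteq> P"
proof -
  define S where "S = {J. fractional J \<and> J \<subseteq> D \<and> t_cl J = J \<and> J \<noteq> D \<and> I \<subseteq> J}"
  have IS: "I \<in> S" using I by (simp add: S_def)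
  have "J \<subseteq> D \<and> t_ideal K D J \<and> t_invertible K D J" if "J \<in> S" for J
    using that inv[of J] by (simp add: S_def t_ideal_def)
  then have "\<exists>P\<in>S. \<forall>J\<in>S. P \<subseteq> J \<longrightarrow> J = P" by (rule t_ACC_maximal[OF acc IS])
  then obtain P where P: "P \<in> S" and max: "\<And>J. J \<in> S \<Longrightarrow> P \<subseteq> J \<Longrightarrow> J = P" by auto
  have P': "fractional P" "P \<subseteq> D" "t_cl P = P" "P \<noteq> D" "I \<subseteq> P" using P by (simp_all add: S_def)
  have "J = P" if "fractional J" "J \<subseteq> D" "t_cl J = J" "J \<noteq> D" "P \<subseteq> J" for J
    by (rule max) (use that P'(5) in \<open>auto simp: S_def\<close>)
  then have "P \<in> max_t_ideals" using P' by (simp add: max_t_ideals_def)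
  then show ?thesis using P'(5) by blast
qed

text \<open>Take \<open>A\<close> maximal among the t-ideals lying in infinitely many maximal
  t-ideals and divide it by one of these, \<open>P\<close>. The quotient \<open>B\<close> is larger,
  hence lies in finitely many. Since \<open>P \<cdot> B \<subseteq> A\<close>, primality shows that
  a maximal t-ideal above \<open>A\<close> is \<open>P\<close> or contains \<open>B\<close>.\<close>

lemma finite_max_t_ideals:
  assumes acc: "t_ACC K D" and inv: "\<And>I. fractional I \<Longrightarrow> I \<subseteq> D \<Longrightarrow> t_invertible K D I"
    and I: "fractional I" "I \<subseteq> D" "t_cl I = I"
  shows "finite {P \<in> max_t_ideals. I \<subseteq> P}"
proof (rule ccontr)
  assume inf: "infinite {P \<in> max_t_ideals. I \<subseteq> P}"
  define S where "S = {J. fractional J \<and> J \<subseteq> D \<and> t_cl J = J \<and> infinite {P \<in> max_t_ideals. J \<subseteq> P}}"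
  have IS: "I \<in> S" using I inf by (simp add: S_def)
  have "J \<subseteq> D \<and> t_ideal K D J \<and> t_invertible K D J" if "J \<in> S" for J
    using that inv[of J] by (simp add: S_def t_ideal_def)
  then have "\<exists>A\<in>S. \<forall>B\<in>S. A \<subseteq> B \<longrightarrow> B = A" by (rule t_ACC_maximal[OF acc IS])
  then obtain A where AS: "A \<in> S" and max: "\<And>B. B \<in> S \<Longrightarrow> A \<subseteq> B \<Longrightarrow> B = A" by auto
  have A: "fractional A" "A \<subseteq> D" "t_cl A = A" "infinite {P \<in> max_t_ideals. A \<subseteq> P}"
    using AS by (simp_all add: S_def)
  obtain P where "P \<in> {P \<in> max_t_ideals. A \<subseteq> P}" using infinite_imp_nonempty[OF A(4)] by blast
  then have P: "P \<in> max_t_ideals" and AP: "A \<subseteq> P" by auto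
  note m = max_t_idealsD[OF P]
  note i = frac_ideal_inv[OF m(1)]
  have P1: "t_cl (P \<cdot> inv_ideal P) = D" using inv[OF m(1,2)] by (simp add: t_invertible_def)
  define B where "B = t_cl (A \<cdot> inv_ideal P)"
  note AP' = frac_prod[OF A(1) i]
  have fB: "fractional B" unfolding B_def by (rule frac_t[OF AP'])
  have "B \<subseteq> t_cl (P \<cdot> inv_ideal P)"
    unfolding B_def using AP by (intro t_mono AP' frac_prod m(1) i prod_le_prod) auto
  then have BD: "B \<subseteq> D" using P1 by simp
  have tB: "t_cl B = B" unfolding B_def by (rule t_idem[OF AP'])
  have "A \<cdot> D \<subseteq> A \<cdot> inv_ideal P"
    using m by (intro prod_le_prod le_ideal_inv frac_D) (auto simp: D_prod)
  then have AB: "A \<subseteq> B" using D_prod(2)[OF A(1)] t_extensive[OF AP'] unfolding B_def by simp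
  \<comment> \<open>Were they equal, cancelling \<open>A\<close> would make the inverse of
    \<open>P\<close> trivial up to closure, and then \<open>P\<close> would be
    \<open>D\<close>.\<close>
  have "B \<noteq> A"
  proof
    assume "B = A"
    then have "t_cl (inv_ideal P) = D"
      using t.star_invertible_cancel[OF _ i, of A] inv[OF A(1,2)] A(3) t_invertible_iff
      by (simp add: B_def)
    then have "t_cl (P \<cdot> D) = D" using t.c_prod_right[OF m(1) i] P1 by simp
    then show False using D_prod(2)[OF m(1)] m by simp
  qed
  then have "B \<notin> S" using max AB by blast
  then have finB: "finite {P \<in> max_t_ideals. B \<subseteq> P}" using fB BD tB by (simp add: S_def)
  have PB: "P \<cdot> B \<subseteq> A"
  proof -
    have "P \<cdot> B \<subseteq> t_cl (P \<cdot> B)" by (intro t_extensive frac_prod m(1) fB)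
    also have "\<dots> = t_cl (P \<cdot> (A \<cdot> inv_ideal P))"
      unfolding B_def by (rule t.c_prod_right[OF m(1) AP'])
    also have "P \<cdot> (A \<cdot> inv_ideal P) = A \<cdot> (P \<cdot> inv_ideal P)" by (rule prod_left_comm[OF m(1) A(1) i])
    also have "t_cl \<dots> = t_cl (A \<cdot> D)"
      using t.c_prod_right[OF A(1) frac_prod[OF m(1) i]] P1 by simp
    finally show ?thesis using D_prod(2)[OF A(1)] A(3) by simp
  qed
  have "Q = P \<or> B \<subseteq> Q" if Q: "Q \<in> max_t_ideals" "A \<subseteq> Q" for Q
  proof (cases "P \<subseteq> Q")
    case True
    then show ?thesis using m(7)[OF Q(1)] by simp
  next
    case False
    then obtain r where r: "r \<in> P" "r \<notin> Q" by blast
    have "b \<in> Q" if b: "b \<in> B" for b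
    proof -
      have "r \<otimes> b \<in> Q" using ideal_prod.prod[OF r(1) b, of K] PB Q(2) by blast
      then show ?thesis using max_t_idealsD(6)[OF Q(1), of r b] r b m(2) BD by blast
    qed
    then show ?thesis by blast
  qed
  then have "{P \<in> max_t_ideals. A \<subseteq> P} \<subseteq> insert P {P \<in> max_t_ideals. B \<subseteq> P}" by blast
  then show False using A(4) finB finite_subset by blast
qed

text \<open>The family consists of one valuation for each maximal t-ideal. Nonnegativity at all of
  them means that the ideal of denominators of \<open>x\<close> lies in no maximal t-ideal; finite
  character comes from \<open>finite_max_t_ideals\<close> for principal ideals.\<close>

lemma all_t_invertible_imp_krull:
  assumes acc: "t_ACC K D" and inv: "\<And>I. fractional I \<Longrightarrow> I \<subseteq> D \<Longrightarrow> t_invertible K D I"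
  shows "krull_domain K D"
proof -
  define p where "p P = (SOME p. uniformized_prime K D P p)" for P
  define w where "w P = uniformized_prime.val K D P (p P)" for P
  have U: "uniformized_prime K D P (p P)" if "P \<in> max_t_ideals" for P
    unfolding p_def
    by (rule someI_ex[OF uniformized_prime_exists[OF _ that]]) (use inv t_invertible_iff in blast)
  have fin: "finite {P \<in> max_t_ideals. x \<in> P}" if x: "x \<in> D" "x \<noteq> \<zero>" for x
  proof -
    have xc: "x \<in> carrier K" using x D_carr by blast
    have "finite {P \<in> max_t_ideals. multiples x \<subseteq> P}"
      by (rule finite_max_t_ideals[OF acc inv frac_multiples[OF xc x(2)]
            multiples_le[OF submodule_D x(1)] t.star_invertible_multiples(2)[OF xc x(2)]])
    moreover have "{P \<in> max_t_ideals. x \<in> P} \<subseteq> {P \<in> max_t_ideals. multiples x \<subseteq> P}"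
      using multiples_le fracE(1) max_t_idealsD(1) by blast
    ultimately show ?thesis by (rule rev_finite_subset)
  qed
  show ?thesis
    unfolding krull_domain_def
  proof (intro exI[of _ "w ` max_t_ideals"] conjI ballI)
    fix v assume "v \<in> w ` max_t_ideals"
    then obtain P where "P \<in> max_t_ideals" "v = w P" by blast
    then show "discrete_valuation K v"
      unfolding w_def by (simp only: uniformized_prime.discrete_valuation_val[OF U])
  next
    fix x assume x: "x \<in> carrier K - {\<zero>}"
    show "x \<in> D \<longleftrightarrow> (\<forall>v\<in>w ` max_t_ideals. 0 \<le> v x)"
    proof
      assume "x \<in> D"
      then have "0 \<le> w P x" if "P \<in> max_t_ideals" for P
        unfolding w_def using uniformized_prime.val_nonneg[OF U[OF that]] x by blast
      then show "\<forall>v\<in>w ` max_t_ideals. 0 \<le> v x" by blast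
    next
      assume nonneg: "\<forall>v\<in>w ` max_t_ideals. 0 \<le> v x"
      \<comment> \<open>These are the \<open>d\<close> in \<open>D\<close> with
        \<open>d \<otimes> x\<close> in \<open>D\<close>. Written as an inverse, this ideal of
        denominators is seen to be a t-ideal.\<close>
      define I where "I = inv_ideal {\<one>, x}"
      have c: "{\<one>, x} \<subseteq> carrier K" using x by auto
      obtain d where d: "d \<in> D" "d \<noteq> \<zero>" "d \<otimes> x \<in> D" using common_denominator x by blast
      have ID: "I \<subseteq> D" by (auto simp: I_def ideal_inv_def)
      have "d \<in> I" using d D_carr by (auto simp: I_def ideal_inv_def)
      then have f: "fractional I"
        using frac_subset[OF submodule_ideal_inv[OF c] frac_D] ID d by (simp add: I_def)
      have tI: "t_cl I = I" using t_closure_ideal_inv[OF c] f by (simp add: I_def)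
      have "I = D"
      proof (rule ccontr)
        assume "I \<noteq> D"
        then obtain P where P: "P \<in> max_t_ideals" "I \<subseteq> P"
          using max_t_ideal_exists[OF acc inv f ID tI] by blast
        have "0 \<le> uniformized_prime.val K D P (p P) x" using nonneg P(1) unfolding w_def by blast
        then obtain b where b: "b \<in> D - P" "b \<otimes> x \<in> D"
          using uniformized_prime.val_nonneg_imp[OF U[OF P(1)]] x by blast
        then have "b \<in> I" using D_carr by (auto simp: I_def ideal_inv_def)
        then show False using P b by blast
      qed
      then have "\<one> \<in> I" by simp
      then show "x \<in> D" using x by (simp add: I_def ideal_inv_def)
    qed
    obtain d where d: "d \<in> D" "d \<noteq> \<zero>" "d \<otimes> x \<in> D" using common_denominator x by blast
    then have dx: "d \<otimes> x \<noteq> \<zero>" using x D_carr by (auto simp: integral_iff)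
    \<comment> \<open>With \<open>x\<close> as the quotient of \<open>d \<otimes> x\<close> by
      \<open>d\<close>, the value vanishes wherever both numerator and denominator avoid
      \<open>P\<close>.\<close>
    have "{v \<in> w ` max_t_ideals. v x \<noteq> 0}
      \<subseteq> w ` ({P \<in> max_t_ideals. d \<in> P} \<union> {P \<in> max_t_ideals. d \<otimes> x \<in> P})"
    proof
      fix v assume "v \<in> {v \<in> w ` max_t_ideals. v x \<noteq> 0}"
      then obtain P where P: "P \<in> max_t_ideals" "v = w P" "w P x \<noteq> 0" by blast
      then have "d \<in> P \<or> d \<otimes> x \<in> P"
        using uniformized_prime.val_eq_0[OF U[OF P(1)], of "d \<otimes> x" d x] d x unfolding w_def by blast
      then show "v \<in> w ` ({P \<in> max_t_ideals. d \<in> P} \<union> {P \<in> max_t_ideals. d \<otimes> x \<in> P})"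
        using P by blast
    qed
    then show "finite {v \<in> w ` max_t_ideals. v x \<noteq> 0}"
      by (rule finite_subset) (use fin[OF d(1,2)] fin[OF d(3) dx] in simp)
  qed
qed

section \<open>From defining valuations to t-invertibility\<close>

lemma discrete_valuationD:
  assumes "discrete_valuation K v" "x \<in> carrier K" "x \<noteq> \<zero>" "y \<in> carrier K" "y \<noteq> \<zero>"
  shows "v (x \<otimes> y) = v x + v y"
  using assms unfolding discrete_valuation_def by blast

text \<open>\<open>F\<close> consists of \<open>a\<close> and, for each of the finitely many
  \<open>v\<close> with \<open>v a \<noteq> 0\<close>, an element of \<open>M\<close> of least
  value. At the remaining \<open>v\<close> the element \<open>a\<close> has value 0, which is least
  since \<open>M \<subseteq> D\<close>. So \<open>F\<close> has the same minima as \<open>M\<close>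
  everywhere, hence the same inverse.\<close>

lemma krull_imp_t_closure_eq_v:
  assumes V: "\<And>v. v \<in> V \<Longrightarrow> discrete_valuation K v"
    and D_iff: "\<And>x. x \<in> carrier K \<Longrightarrow> x \<noteq> \<zero> \<Longrightarrow> x \<in> D \<longleftrightarrow> (\<forall>v \<in> V. 0 \<le> v x)"
    and fin: "\<And>x. x \<in> carrier K \<Longrightarrow> x \<noteq> \<zero> \<Longrightarrow> finite {v \<in> V. v x \<noteq> 0}"
    and M: "fractional M" "M \<subseteq> D"
  shows "v_cl M \<subseteq> t_cl M"
proof -
  obtain a where a: "a \<in> M" "a \<noteq> \<zero>" using fracE(2)[OF M(1)] by blast
  note Mc = fracE(4)[OF M(1)]
  define S where "S = {v \<in> V. v a \<noteq> 0}"
  have finS: "finite S" unfolding S_def using fin[OF Mc[OF a(1)] a(2)] .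
  have pos: "0 \<le> v x" if "v \<in> V" "x \<in> M" "x \<noteq> \<zero>" for v x
    using D_iff[OF Mc[OF that(2)] that(3)] that M by blast
  have "\<exists>x. x \<in> M \<and> x \<noteq> \<zero> \<and> (\<forall>y. y \<in> M \<and> y \<noteq> \<zero> \<longrightarrow> v x \<le> v y)" if v: "v \<in> V" for v
  proof -
    \<comment> \<open>Values on \<open>M\<close> are nonnegative, so the least one can be found
      among the natural numbers.\<close>
    have "\<exists>x. (x \<in> M \<and> x \<noteq> \<zero>) \<and> (\<forall>y. y \<in> M \<and> y \<noteq> \<zero> \<longrightarrow> nat (v x) \<le> nat (v y))"
      by (rule ex_has_least_nat) (use a in blast)
    then show ?thesis using pos[OF v] by (metis nat_le_eq_zle order_le_less)
  qed
  then obtain m where m: "\<And>v. v \<in> V \<Longrightarrow> m v \<in> M \<and> m v \<noteq> \<zero> \<and> (\<forall>y. y \<in> M \<and> y \<noteq> \<zero> \<longrightarrow> v (m v) \<le> v y)"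
    by metis
  define F where "F = insert a (m ` S)"
  have F: "finite F" "F \<subseteq> M" "\<exists>u\<in>F. u \<noteq> \<zero>" using finS a m by (auto simp: F_def S_def)
  have F0: "u \<noteq> \<zero>" if u: "u \<in> F" for u
  proof (cases "u = a")
    case False
    then obtain v where "v \<in> V" "u = m v" using u by (auto simp: F_def S_def)
    then show ?thesis using m by simp
  qed (use a in simp)
  have "inv_ideal F \<subseteq> inv_ideal M"
  proof
    fix y assume y: "y \<in> inv_ideal F"
    then have yc: "y \<in> carrier K" using ideal_invD by blast
    have "y \<otimes> x \<in> D" if x: "x \<in> M" for x
    proof (cases "y = \<zero> \<or> x = \<zero>")
      case True
      then show ?thesis using yc Mc[OF x] by auto
    next
      case False
      then have yx: "y \<otimes> x \<noteq> \<zero>" using yc Mc[OF x] by (simp add: integral_iff)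
      have yu: "0 \<le> v y + v u" if "u \<in> F" "v \<in> V" for u v
      proof -
        have uc: "u \<in> carrier K" using that F Mc by blast
        have "y \<otimes> u \<noteq> \<zero>" using yc uc False F0 that by (simp add: integral_iff)
        then have "0 \<le> v (y \<otimes> u)" using D_iff[of "y \<otimes> u"] ideal_invD(1)[OF y that(1)] yc uc that by auto
        then show ?thesis using discrete_valuationD[OF V[OF that(2)] yc _ uc] False F0 that by simp
      qed
      have "0 \<le> v (y \<otimes> x)" if v: "v \<in> V" for v
      proof -
        have e: "v (y \<otimes> x) = v y + v x"
          using discrete_valuationD[OF V[OF v] yc _ Mc[OF x]] False by simp
        show ?thesis
        proof (cases "v a = 0")
          case True
          then show ?thesis using e yu[of a v] v pos[OF v x] False by (simp add: F_def)
        next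
          case 2: False
          then have "m v \<in> F" using v by (simp add: F_def S_def)
          then have "0 \<le> v y + v (m v)" using yu v by blast
          moreover have "v (m v) \<le> v x" using m[OF v] x False by blast
          ultimately show ?thesis using e by simp
        qed
      qed
      then show ?thesis using D_iff[OF _ yx] yc Mc[OF x] by simp
    qed
    then show "y \<in> inv_ideal M" using yc by (auto simp: ideal_inv_def)
  qed
  then have "v_cl M \<subseteq> v_cl F" unfolding v_closure_def by (rule ideal_inv_antimono)
  then show ?thesis using F unfolding subset_iff[of "v_cl M"] t_closure_iff[OF M(1)] by blast
qed

text \<open>Let \<open>M\<close> be the product of \<open>I\<close> and its inverse. An element
  \<open>z\<close> of the inverse of \<open>M\<close> maps \<open>inv_ideal I\<close> into itself,
  so all its powers lie there and have a common denominator \<open>a\<close>. This bounds n times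
  \<open>v z\<close> from below for all n, whence \<open>z \<in> D\<close>. So the v-closure of
  \<open>M\<close> reaches \<open>D\<close>, and the t-closure with it.\<close>

lemma krull_imp_t_invertible:
  assumes "krull_domain K D" and I: "fractional I" "I \<subseteq> D"
  shows "t_invertible K D I"
proof -
  obtain V where V0: "\<forall>v\<in>V. discrete_valuation K v"
    "\<forall>x\<in>carrier K - {\<zero>}. x \<in> D \<longleftrightarrow> (\<forall>v \<in> V. 0 \<le> v x)"
    "\<forall>x\<in>carrier K - {\<zero>}. finite {v \<in> V. v x \<noteq> 0}"
    using assms(1) unfolding krull_domain_def by (elim exE conjE)
  have V: "discrete_valuation K v" if "v \<in> V" for v using V0(1) that by blast
  have D_iff: "x \<in> D \<longleftrightarrow> (\<forall>v \<in> V. 0 \<le> v x)" if "x \<in> carrier K" "x \<noteq> \<zero>" for x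
    using bspec[OF V0(2), of x] that by simp
  have fin: "finite {v \<in> V. v x \<noteq> 0}" if "x \<in> carrier K" "x \<noteq> \<zero>" for x
    using bspec[OF V0(3), of x] that by simp
  note i = frac_ideal_inv[OF I(1)]
  define M where "M = I \<cdot> inv_ideal I"
  have M: "fractional M" "M \<subseteq> D" unfolding M_def using frac_prod[OF I(1) i] prod_inv_le[OF I(1)] by auto
  have "inv_ideal M \<subseteq> D"
  proof
    fix z assume z: "z \<in> inv_ideal M"
    then have zc: "z \<in> carrier K" using ideal_invD by blast
    show "z \<in> D"
    proof (cases "z = \<zero>")
      case False
      obtain a where a: "a \<in> I" "a \<noteq> \<zero>" using fracE(2)[OF I(1)] by blast
      have ac: "a \<in> carrier K" using a fracE(4)[OF I(1)] by blast
      have step: "z \<otimes> y \<in> inv_ideal I" if y: "y \<in> inv_ideal I" for y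
      proof -
        have yc: "y \<in> carrier K" using y ideal_invD by blast
        have "z \<otimes> y \<otimes> x \<in> D" if x: "x \<in> I" for x
        proof -
          have "z \<otimes> y \<otimes> x = z \<otimes> (x \<otimes> y)" using zc yc fracE(4)[OF I(1) x] by (simp add: m_ac)
          then show ?thesis
            using ideal_invD(1)[OF z, of "x \<otimes> y"] ideal_prod.prod[OF x y, of K] by (simp add: M_def)
        qed
        then show ?thesis using zc yc by (auto simp: ideal_inv_def)
      qed
      have zpow: "z [^] (n::nat) \<in> inv_ideal I" for n
      proof (induction n)
        case 0
        then show ?case using one_in_ideal_inv[OF I] by simp
      next
        case (Suc n)
        then show ?case using step[OF Suc] zc by (simp add: m_comm)
      qed
      have "0 \<le> v z" if v: "v \<in> V" for v
      proof -
        have nz: "z [^] (n::nat) \<noteq> \<zero>" for n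
          using False zc by (induction n) (simp_all add: integral_iff)
        have vn: "v (z [^] n \<otimes> a) = int n * v z + v a" for n :: nat
        proof (induction n)
          case 0
          then show ?case using ac by simp
        next
          case (Suc n)
          have "z [^] Suc n \<otimes> a = z \<otimes> (z [^] n \<otimes> a)" using zc ac by (simp add: m_ac)
          moreover have "z [^] n \<otimes> a \<noteq> \<zero>" using nz zc ac a by (simp add: integral_iff)
          ultimately have "v (z [^] Suc n \<otimes> a) = v z + v (z [^] n \<otimes> a)"
            using discrete_valuationD[OF V[OF v] zc False] zc ac by simp
          then show ?case using Suc by (simp add: algebra_simps)
        qed
        have ge: "0 \<le> int n * v z + v a" for n :: nat
        proof -
          have "z [^] n \<otimes> a \<in> D" using ideal_invD(1)[OF zpow a(1)] .
          moreover have "z [^] n \<otimes> a \<noteq> \<zero>" using nz zc ac a by (simp add: integral_iff)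
          ultimately show ?thesis using D_iff[of "z [^] n \<otimes> a"] zc ac v vn by auto
        qed
        show ?thesis
        proof (rule ccontr)
          assume "\<not> 0 \<le> v z"
          then have "v z \<le> - 1" by simp
          \<comment> \<open>The exponent exceeds the value of \<open>a\<close> by one, enough for a
            negative \<open>v z\<close> to push the sum below zero; the case n = 0 supplies
            \<open>0 \<le> v a\<close>.\<close>
          then have "int (nat (v a) + 1) * v z \<le> int (nat (v a) + 1) * (- 1)"
            by (intro mult_left_mono) auto
          then show False using ge[of "nat (v a) + 1"] ge[of 0] by simp
        qed
      qed
      then show ?thesis using D_iff[OF zc False] by simp
    qed simp
  qed
  then have "D \<subseteq> v_cl M" using ideal_inv_antimono[of "inv_ideal M" D] ideal_inv_D by (simp add: v_closure_def)
  moreover have "v_cl M \<subseteq> t_cl M" by (rule krull_imp_t_closure_eq_v[OF V D_iff fin M])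
  moreover have "t_cl M \<subseteq> D" by (rule t.c_le_D[OF M])
  ultimately have "t_cl M = D" by blast
  then show ?thesis using I by (simp add: t_invertible_def M_def)
qed

lemma proper_t_ideals_iff:
  "I \<in> proper_t_ideals K D \<longleftrightarrow> fractional I \<and> I \<subseteq> D \<and> t_cl I = I \<and> I \<noteq> D"
  by (auto simp: proper_t_ideals_def proper_ideals_iff t_ideal_def)

text \<open>The group consists of the t-invertible t-ideals under the t-closed product. It captures
  t-closed integral ideals only; any other integral ideal is t-invertible because its t-closure
  is.\<close>

lemma krull_domain_iff:
  assumes "t_ACC K D"
  shows "krull_domain K D \<longleftrightarrow>
    proper_t_ideals K D \<lhd>\<^sub>P (\<lambda>J. J \<noteq> D \<and> t_invertible K D J \<and> t_ideal K D J)"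
proof
  assume k: "krull_domain K D"
  show "proper_t_ideals K D \<lhd>\<^sub>P (\<lambda>J. J \<noteq> D \<and> t_invertible K D J \<and> t_ideal K D J)"
    unfolding each_contained_in_def
  proof
    fix s assume s: "s \<in> proper_t_ideals K D"
    then have "s \<noteq> D \<and> t_invertible K D s \<and> t_ideal K D s"
      using krull_imp_t_invertible[OF k, of s] by (auto simp: proper_t_ideals_iff t_ideal_def)
    then show "\<exists>g\<in>proper_t_ideals K D. s \<subseteq> g \<and> g \<noteq> D \<and> t_invertible K D g \<and> t_ideal K D g"
      using s by blast
  qed
next
  assume cov: "proper_t_ideals K D \<lhd>\<^sub>P (\<lambda>J. J \<noteq> D \<and> t_invertible K D J \<and> t_ideal K D J)"
  define H where "H = {M. t.star_invertible M \<and> t_cl M = M}"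
  have H: "I \<in> H" if I: "fractional I" "I \<subseteq> D" "t_cl I = I" for I
  proof (rule t.all_in_group[OF assms])
    fix A assume A: "A \<in> H"
    then have fA: "fractional A" by (auto simp: H_def t.star_invertible_def)
    show "t.star_invertible A \<and> t_cl A = A" using A by (simp add: H_def)
    show "inv_ideal A \<in> H"
      using A t.star_invertible_inv t.c_ideal_inv[OF fA] by (simp add: H_def)
    show "t_ideal K D A \<and> t_invertible K D A"
      using A fA by (simp add: H_def t_ideal_def t_invertible_iff)
    fix B assume B: "B \<in> H"
    then have "fractional B" by (auto simp: H_def t.star_invertible_def)
    then have "fractional (A \<cdot> B)" using fA frac_prod by blast
    then show "t_cl (A \<cdot> B) \<in> H"
      using A B t.star_invertible_prod[of A B] t.star_invertible_c t_idem by (simp add: H_def)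
  next
    fix x assume "x \<in> carrier K" "x \<noteq> \<zero>"
    then show "multiples x \<in> H" using t.star_invertible_multiples by (simp add: H_def)
  next
    fix I assume "fractional I" "I \<subseteq> D" "t_cl I = I" "I \<noteq> D"
    then have "I \<in> proper_t_ideals K D" by (simp add: proper_t_ideals_iff)
    from each_contained_inD[OF cov this]
    obtain J where "J \<in> proper_t_ideals K D" "I \<subseteq> J" "t_invertible K D J" by blast
    then show "\<exists>J\<in>H. I \<subseteq> J \<and> J \<subseteq> D \<and> J \<noteq> D"
      by (intro bexI[of _ J]) (auto simp: H_def t_invertible_iff proper_t_ideals_iff)
  qed (use I in auto)
  have "t_invertible K D I" if I: "fractional I" "I \<subseteq> D" for I
  proof -
    have "t_cl I \<in> H" by (rule H[OF frac_t[OF I(1)] t.c_le_D[OF I] t_idem[OF I(1)]])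
    then show ?thesis using t.star_invertible_c[OF I(1)] by (simp add: H_def t_invertible_iff)
  qed
  then show "krull_domain K D" by (rule all_t_invertible_imp_krull[OF assms])
qed

end

theorem proposition4:
  fixes K :: "('a, 'b) ring_scheme" and D :: "'a set"
  assumes "quotient_field K D"
    and "\<not> field (K\<lparr>carrier := D\<rparr>)"
    and "t_ACC K D"
  shows "(principal_domain (K\<lparr>carrier := D\<rparr>) \<longleftrightarrow>
            proper_ideals K D \<lhd>\<^sub>P
              (\<lambda>J. J \<noteq> D \<and> J \<noteq> {\<zero>\<^bsub>K\<^esub>} \<and> principalideal J (K\<lparr>carrier := D\<rparr>))) \<and>
         (dedekind_domain K D \<longleftrightarrow>
            proper_ideals K D \<lhd>\<^sub>P (\<lambda>J. J \<noteq> D \<and> invertible_ideal K D J)) \<and>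
         (krull_domain K D \<longleftrightarrow>
            proper_t_ideals K D \<lhd>\<^sub>P (\<lambda>J. J \<noteq> D \<and> t_invertible K D J \<and> t_ideal K D J))"
  using quotient_field.principal_domain_iff[OF assms(1,3)]
    quotient_field.dedekind_domain_iff[OF assms(1,3)]
    quotient_field.krull_domain_iff[OF assms(1,3)] by blast

end
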